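(* Let $\Gamma_{G_{2,1}}$ be any finite generating set of the Thompson group $G_{2,1}$. Let $g:\{0,1\}^m\to\{0,1\}^m$ be any permutation and let $C_g$ and $C_{g^{-1}}$ be minimum-size circuits that compute $g$, respectively $g^{-1}$. Then there exists a word $W_{(g,g^{-1})}$ over the generating set $\Gamma_{G_{2,1}}\cup\{\tau_{i,i+1}:1\le i\}$ of $G_{2,1}$, representing an element $w_{(g,g^{-1})}\in G_{2,1}$, such that: (1) For all $x\in{\rm Dom}(g)$ and all $y\in{\rm Im}(g)$: $$w_{(g,g^{-1})}(0\,x)=0\,g(x)\quad\text{and}\quad (w_{(g,g^{-1})})^{-1}(0\,y)=0\,g^{-1}(y),$$ where $(w_{(g,g^{-1})})^{-1}\in G_{2,1}$ is represented by the free-group inverse $(W_{(g,g^{-1})})^{-1}$ of the word $W_{(g,g^{-1})}$. (2) $w_{(g,g^{-1})}$ and $(w_{(g,g^{-1})})^{-1}$ stabilize both $0\{0,1\}^*$ and $1\{0,1\}^*$ (i.e., each of them maps $0\{0,1\}^*$ into $0\{0,1\}^*$ and $1\{0,1\}^*$ into $1\{0,1\}^*$, where defined). (3) $|W_{(g,g^{-1})}|=|(W_{(g,g^{-1})})^{-1}|\le O(|C_g|^4+|C_{g^{-1}}|^4)$ (with an implied constant not depending on $g,m$). (4) The largest subscript of transpositions $\tau_{i,i+1}$ occurring in $W_{(g,g^{-1})}$ is $\le\max\{|C_g|^2,|C_{g^{-1}}|^2\}+2$.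
   Context: Thompson group. Let $\{0,1\}^*$ be the set of finite bitstrings. A right ideal is a set $R\subseteq\{0,1\}^*$ with $R\{0,1\}^*\subseteq R$; it is essential if it meets every (non-empty) right ideal. An isomorphism between right ideals $R_1,R_2$ is a bijection $\varphi:R_1\to R_2$ with $\varphi(rz)=\varphi(r)z$ for all $r\in R_1,z\in\{0,1\}^*$. Every isomorphism $\varphi$ between essential right ideals has a unique maximal extension $\max(\varphi)$ among isomorphisms between essential right ideals. $G_{2,1}$ is the group of all maximally extended isomorphisms between finitely generated essential right ideals of $\{0,1\}^*$, with product $\varphi\cdot\psi=\max(\varphi\circ\psi)$; it acts partially on $\{0,1\}^*$ on the left. The bit transposition $\tau_{i,j}\in G_{2,1}$ ($1\le i<j$) is $ux_ivx_jw\mapsto ux_jvx_iw$, where $|u|=i-1$, $|v|=j-i-1$, $x_i,x_j\in\{0,1\}$, $w\in\{0,1\}^*$. Circuits. A circuit computing $f:\{0,1\}^m\to\{0,1\}^n$ is an acyclic boolean circuit with $m$ input ports and $n$ output ports made from gates $\wedge$ (and), $\vee$ (or), $\neg$ (not), fork: $x\mapsto(x,x)$, each applicable to any wires, and wire-swappings $\tau_{i,j}$ exchanging the $i$th and $j$th wires. The size $|C|$ of a circuit $C$ is the number of its gates, including forks and wire-swappings, as well as the input ports and the output ports. $|W|$ denotes the length of a word $W$. Here ${\rm Dom}(g)={\rm Im}(g)=\{0,1\}^m$. *)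

theory Defs
  imports Complex_Main "HOL-Algebra.Generated_Groups"
begin

section \<open>The Thompson group\<close>

text \<open>Bits are booleans, with False for 0 and True for 1.  Partial maps on bitstrings
  (\<open>\<rightharpoonup>\<close>) carry their domain as \<open>dom\<close>.\<close>

type_synonym bits = "bool list"

definition bitstrings :: "nat \<Rightarrow> bits set" where
  "bitstrings m = {x. length x = m}"

definition right_ideal :: "bits set \<Rightarrow> bool" where
  "right_ideal R \<longleftrightarrow> (\<forall>r\<in>R. \<forall>z. r @ z \<in> R)"

definition essential :: "bits set \<Rightarrow> bool" where
  "essential R \<longleftrightarrow> right_ideal R \<and> (\<forall>S. right_ideal S \<and> S \<noteq> {} \<longrightarrow> R \<inter> S \<noteq> {})"

definition finitely_generated :: "bits set \<Rightarrow> bool" where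
  "finitely_generated R \<longleftrightarrow> (\<exists>F. finite F \<and> R = {r @ z | r z. r \<in> F})"

definition ideal_iso :: "bits set \<Rightarrow> bits set \<Rightarrow> (bits \<rightharpoonup> bits) \<Rightarrow> bool" where
  "ideal_iso R\<^sub>1 R\<^sub>2 \<phi> \<longleftrightarrow>
     right_ideal R\<^sub>1 \<and> right_ideal R\<^sub>2 \<and> dom \<phi> = R\<^sub>1 \<and>
     bij_betw (\<lambda>r. the (\<phi> r)) R\<^sub>1 R\<^sub>2 \<and>
     (\<forall>r\<in>R\<^sub>1. \<forall>z. the (\<phi> (r @ z)) = the (\<phi> r) @ z)"

definition essential_iso :: "(bits \<rightharpoonup> bits) \<Rightarrow> bool" where
  "essential_iso \<phi> \<longleftrightarrow> (\<exists>R\<^sub>1 R\<^sub>2. essential R\<^sub>1 \<and> essential R\<^sub>2 \<and> ideal_iso R\<^sub>1 R\<^sub>2 \<phi>)"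

definition fg_essential_iso :: "(bits \<rightharpoonup> bits) \<Rightarrow> bool" where
  "fg_essential_iso \<phi> \<longleftrightarrow>
     (\<exists>R\<^sub>1 R\<^sub>2. essential R\<^sub>1 \<and> finitely_generated R\<^sub>1 \<and>
              essential R\<^sub>2 \<and> finitely_generated R\<^sub>2 \<and> ideal_iso R\<^sub>1 R\<^sub>2 \<phi>)"

definition maximal_iso :: "(bits \<rightharpoonup> bits) \<Rightarrow> bool" where
  "maximal_iso \<phi> \<longleftrightarrow>
     essential_iso \<phi> \<and> (\<forall>\<psi>. essential_iso \<psi> \<and> \<phi> \<subseteq>\<^sub>m \<psi> \<longrightarrow> \<psi> = \<phi>)"

definition max_ext :: "(bits \<rightharpoonup> bits) \<Rightarrow> (bits \<rightharpoonup> bits)" where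
  "max_ext \<phi> = (THE \<psi>. maximal_iso \<psi> \<and> \<phi> \<subseteq>\<^sub>m \<psi>)"

definition G21 :: "(bits \<rightharpoonup> bits) monoid" where
  "G21 = \<lparr>carrier = {\<phi>. fg_essential_iso \<phi> \<and> maximal_iso \<phi>},
          monoid.mult = (\<lambda>\<phi> \<psi>. max_ext (\<phi> \<circ>\<^sub>m \<psi>)),
          one = Some\<rparr>"

text \<open>Positions are counted from 1, so the intended range is \<open>1 \<le> i < j\<close>.  The map is already
  maximally extended: it has no extension to a string shorter than \<open>j\<close>.\<close>

definition bit_transposition :: "nat \<Rightarrow> nat \<Rightarrow> (bits \<rightharpoonup> bits)" where
  "bit_transposition i j =
     (\<lambda>x. if j \<le> length x then Some (x[i - 1 := x ! (j - 1), j - 1 := x ! (i - 1)]) else None)"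

definition stabilizes :: "(bits \<rightharpoonup> bits) \<Rightarrow> bool \<Rightarrow> bool" where
  "stabilizes \<phi> b \<longleftrightarrow> (\<forall>x y. \<phi> (b # x) = Some y \<longrightarrow> (\<exists>z. y = b # z))"


section \<open>Words\<close>

text \<open>Letters are formal symbols: \<open>Gen \<phi>\<close> for a generator from \<open>\<Gamma>\<close>, and \<open>Tau i\<close> for the
  transposition of positions \<open>i\<close> and \<open>i + 1\<close>.  If \<open>\<Gamma>\<close> happens to contain some such transposition,
  using it as an element of \<open>\<Gamma>\<close> does not count as an occurrence of \<open>Tau i\<close>.
  Words are free-group words: a letter paired with False stands for its formal inverse.\<close>

datatype letter = Gen "bits \<rightharpoonup> bits" | Tau nat

type_synonym word = "(letter \<times> bool) list"

definition words_over :: "(bits \<rightharpoonup> bits) set \<Rightarrow> word set" where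
  "words_over \<Gamma> = lists ((Gen ` \<Gamma> \<union> Tau ` {1..}) \<times> UNIV)"

primrec letter_value :: "letter \<Rightarrow> (bits \<rightharpoonup> bits)" where
  "letter_value (Gen \<phi>) = \<phi>"
| "letter_value (Tau i) = bit_transposition i (i + 1)"

definition signed_value :: "letter \<times> bool \<Rightarrow> (bits \<rightharpoonup> bits)" where
  "signed_value = (\<lambda>(l, s). if s then letter_value l else inv\<^bsub>G21\<^esub> letter_value l)"

definition word_value :: "word \<Rightarrow> (bits \<rightharpoonup> bits)" where
  "word_value W = foldr (\<lambda>l \<phi>. signed_value l \<otimes>\<^bsub>G21\<^esub> \<phi>) W \<one>\<^bsub>G21\<^esub>"

definition word_inverse :: "word \<Rightarrow> word" where
  "word_inverse W = rev (map (\<lambda>(l, s). (l, \<not> s)) W)"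


section \<open>Circuits\<close>

text \<open>An acyclic circuit is presented by its gates in topological order, acting one after the other
  on an ordered list of wires (indexed from 0 here).  A binary gate applied to wires \<open>i\<close> and \<open>j\<close>
  consumes both and puts its output in the place of wire \<open>i\<close>; a fork of wire \<open>i\<close> puts the two
  copies next to each other.  Wires cannot be duplicated or discarded for free, so
  the wires left after the last gate are exactly those leading to the output ports.\<close>

datatype gate =
    AndGate nat nat
  | OrGate nat nat
  | NotGate nat
  | ForkGate nat
  | SwapGate nat nat

fun gate_applicable :: "nat \<Rightarrow> gate \<Rightarrow> bool" where
  "gate_applicable k (AndGate i j) \<longleftrightarrow> i < k \<and> j < k \<and> i \<noteq> j"
| "gate_applicable k (OrGate i j) \<longleftrightarrow> i < k \<and> j < k \<and> i \<noteq> j"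
| "gate_applicable k (NotGate i) \<longleftrightarrow> i < k"
| "gate_applicable k (ForkGate i) \<longleftrightarrow> i < k"
| "gate_applicable k (SwapGate i j) \<longleftrightarrow> i < j \<and> j < k"

fun wires_after :: "nat \<Rightarrow> gate \<Rightarrow> nat" where
  "wires_after k (AndGate i j) = k - 1"
| "wires_after k (OrGate i j) = k - 1"
| "wires_after k (NotGate i) = k"
| "wires_after k (ForkGate i) = k + 1"
| "wires_after k (SwapGate i j) = k"

definition remove_wire :: "nat \<Rightarrow> bits \<Rightarrow> bits" where
  "remove_wire j x = take j x @ drop (Suc j) x"

fun apply_gate :: "gate \<Rightarrow> bits \<Rightarrow> bits" where
  "apply_gate (AndGate i j) x = remove_wire j (x[i := x ! i \<and> x ! j])"
| "apply_gate (OrGate i j) x = remove_wire j (x[i := x ! i \<or> x ! j])"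
| "apply_gate (NotGate i) x = x[i := \<not> x ! i]"
| "apply_gate (ForkGate i) x = take i x @ [x ! i, x ! i] @ drop (Suc i) x"
| "apply_gate (SwapGate i j) x = x[i := x ! j, j := x ! i]"

fun gates_connect :: "nat \<Rightarrow> gate list \<Rightarrow> nat \<Rightarrow> bool" where
  "gates_connect k [] n \<longleftrightarrow> k = n"
| "gates_connect k (a # as) n \<longleftrightarrow> gate_applicable k a \<and> gates_connect (wires_after k a) as n"

record circuit =
  num_inputs :: nat
  num_outputs :: nat
  gates :: "gate list"

definition circuit_size :: "circuit \<Rightarrow> nat" where
  "circuit_size C = length (gates C) + num_inputs C + num_outputs C"

definition computes :: "circuit \<Rightarrow> nat \<Rightarrow> nat \<Rightarrow> (bits \<Rightarrow> bits) \<Rightarrow> bool" where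
  "computes C m n f \<longleftrightarrow>
     num_inputs C = m \<and> num_outputs C = n \<and> gates_connect m (gates C) n \<and>
     (\<forall>x\<in>bitstrings m. fold apply_gate (gates C) x = f x)"

definition min_circuit :: "circuit \<Rightarrow> nat \<Rightarrow> nat \<Rightarrow> (bits \<Rightarrow> bits) \<Rightarrow> bool" where
  "min_circuit C m n f \<longleftrightarrow>
     computes C m n f \<and> (\<forall>C'. computes C' m n f \<longrightarrow> circuit_size C \<le> circuit_size C')"

end

theory Submission
  imports Defs "HOL-Library.Omega_Words_Fun" "HOL-Combinatorics.Permutations"
begin

text \<open>
  An element of \<open>G21\<close> is the same thing as a bijection of the Cantor space that replaces
  prefixes; its maximal partial action on bitstrings is recovered from the bijection. On inputs starting
  with \<open>0\<close>, an element of \<open>G21\<close> acting as \<open>0 t \<mapsto> 0 0 t\<close>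
  produces as many zero bits as one wants, and these serve as registers for a reversible program
  \<open>P\<close>. Each gate writes its output by exclusive or into a fresh zero register, so every
  circuit can be run and then undone. Computing, copying and uncomputing with \<open>C\<^sub>g\<close>
  turns \<open>0\<^sup>m x\<close> into \<open>g(x) x\<close>; doing the same with
  \<open>C\<^sub>g\<^sub>i\<close> clears \<open>x\<close>; two more copies move \<open>g(x)\<close> to
  its place. Each instruction of \<open>P\<close> acts on the front of the string after linearly many
  adjacent transpositions, which gives even a quadratic bound on the word length. Since \<open>w\<close>
  permutes the sequences starting with \<open>0\<close>, it also permutes those starting with
  \<open>1\<close>.
\<close>

section \<open>Prefix replacing bijections of the Cantor space\<close>

type_synonym cantor = "nat \<Rightarrow> bool"

text \<open>Since all infinite tails are tested, every prefix replacement performed by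
  \<open>f\<close> is recorded, even at the shortest possible prefix; the partial map read off from
  it has nothing left to extend.\<close>

definition sends :: "(cantor \<Rightarrow> cantor) \<Rightarrow> bits \<Rightarrow> bits \<Rightarrow> bool" where
  "sends f x y \<longleftrightarrow> (\<forall>s. f (x \<frown> s) = y \<frown> s)"

text \<open>The uniform length \<open>N\<close> corresponds to a finitely generated essential
  domain. The same condition for the inverse is a consequence, see
  \<open>inv_prefix_bijection\<close>.\<close>

definition prefix_bijections :: "(cantor \<Rightarrow> cantor) set" where
  "prefix_bijections = {f. bij f \<and> (\<exists>N. \<forall>x. length x = N \<longrightarrow> (\<exists>y. sends f x y))}"

definition partial_action :: "(cantor \<Rightarrow> cantor) \<Rightarrow> (bits \<rightharpoonup> bits)" where
  "partial_action f = (\<lambda>x. if \<exists>y. sends f x y then Some (THE y. sends f x y) else None)"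

text \<open>The tail is chosen diagonally: its bits all disagree with the bit of \<open>y'\<close>
  at position \<open>length y\<close>, where the tail has begun on the left while \<open>y'\<close>
  still runs on the right.\<close>

lemma conc_inject_less:
  fixes y y' :: bits
  assumes "\<forall>s. y \<frown> s = y' \<frown> s" "length y < length y'"
  shows False
proof -
  have "(y \<frown> (\<lambda>_. \<not> y' ! length y)) (length y) = (y' \<frown> (\<lambda>_. \<not> y' ! length y)) (length y)"
    using assms(1) by metis
  then show False using assms(2) by simp
qed

lemma conc_inject:
  fixes y y' :: bits
  assumes "\<forall>s. y \<frown> s = y' \<frown> s"
  shows "y = y'"
proof -
  have "length y = length y'"
    using conc_inject_less[of y y'] conc_inject_less[of y' y] assms by (metis linorder_neqE_nat)
  then show ?thesis using assms by (metis concat_eq)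
qed

lemma sends_unique: "sends f x y \<Longrightarrow> sends f x y' \<Longrightarrow> y = y'"
  unfolding sends_def by (rule conc_inject) metis

lemma sends_append: "sends f x y \<Longrightarrow> sends f (x @ z) (y @ z)"
  unfolding sends_def by (metis conc_conc)

lemma sends_comp: "sends f y z \<Longrightarrow> sends g x y \<Longrightarrow> sends (f \<circ> g) x z"
  unfolding sends_def by simp

lemma sends_inv: "bij f \<Longrightarrow> sends f x y \<Longrightarrow> sends (inv_into UNIV f) y x"
  unfolding sends_def by (metis bij_inv_eq_iff)

lemma sends_inv_iff: "bij f \<Longrightarrow> sends (inv_into UNIV f) y x \<longleftrightarrow> sends f x y"
  by (metis sends_inv inv_inv_eq bij_imp_bij_inv)

lemma partial_action_Some [simp]: "partial_action f x = Some y \<longleftrightarrow> sends f x y"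
  unfolding partial_action_def by (auto intro: sends_unique the_equality theI2)

lemma dom_partial_action: "dom (partial_action f) = {x. \<exists>y. sends f x y}"
  unfolding dom_def by simp

lemma prefix_bijection_bij: "f \<in> prefix_bijections \<Longrightarrow> bij f"
  unfolding prefix_bijections_def by simp

lemma prefix_bijection_sends:
  assumes "f \<in> prefix_bijections"
  obtains N where "\<And>x. N \<le> length x \<Longrightarrow> \<exists>y. sends f x y"
proof -
  from assms obtain N where N: "\<And>x. length x = N \<Longrightarrow> \<exists>y. sends f x y"
    unfolding prefix_bijections_def by auto
  have "\<exists>y. sends f x y" if "N \<le> length x" for x
    using N[of "take N x"] that sends_append[of f "take N x" _ "drop N x"] by auto
  then show thesis using that by blast
qed

text \<open>Bits beyond the replaced prefix are copied, so outputs can be made long enough to feed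
  the second map of a composite.\<close>

lemma prefix_bijection_sends_long:
  assumes "f \<in> prefix_bijections"
  obtains N where "\<And>x. N \<le> length x \<Longrightarrow> \<exists>y. M \<le> length y \<and> sends f x y"
proof -
  obtain N where N: "\<And>x. N \<le> length x \<Longrightarrow> \<exists>y. sends f x y"
    using prefix_bijection_sends[OF assms] by metis
  have "\<exists>y. M \<le> length y \<and> sends f x y" if x: "N + M \<le> length x" for x
  proof -
    obtain y where "sends f (take N x) y" using N[of "take N x"] x by auto
    then have "sends f x (y @ drop N x)"
      using sends_append[of f "take N x" y "drop N x"] by simp
    then show ?thesis using x by force
  qed
  then show thesis using that by blast
qed

section \<open>Composition and inversion of prefix bijections\<close>

lemma id_prefix_bijection: "id \<in> prefix_bijections"
  unfolding prefix_bijections_def sends_def by auto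

lemma comp_prefix_bijection:
  assumes f: "f \<in> prefix_bijections" and g: "g \<in> prefix_bijections"
  shows "f \<circ> g \<in> prefix_bijections"
proof -
  obtain M where M: "\<And>x. M \<le> length x \<Longrightarrow> \<exists>y. sends f x y"
    using prefix_bijection_sends[OF f] by metis
  obtain N where "\<And>x. N \<le> length x \<Longrightarrow> \<exists>y. M \<le> length y \<and> sends g x y"
    using prefix_bijection_sends_long[OF g] by metis
  then have "\<forall>x. length x = N \<longrightarrow> (\<exists>y. sends (f \<circ> g) x y)"
    using M sends_comp by (metis order_refl)
  then show ?thesis
    using f g bij_comp unfolding prefix_bijections_def by blast
qed

lemma conc_eq_prefix:
  assumes "y \<frown> s = u \<frown> t" "length y \<le> length u"
  shows "u = y @ drop (length y) u" "s = drop (length y) u \<frown> t"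
proof -
  have *: "u \<frown> t = take (length y) u \<frown> (drop (length y) u \<frown> t)" by simp
  have "y \<frown> s = take (length y) u \<frown> (drop (length y) u \<frown> t)"
    by (rule trans[OF assms(1) *])
  moreover have "length y = length (take (length y) u)" using assms(2) by simp
  ultimately have "y = take (length y) u \<and> s = drop (length y) u \<frown> t"
    using concat_eq by blast
  then show "s = drop (length y) u \<frown> t" "u = y @ drop (length y) u"
    by (metis append_take_drop_id)+
qed

lemma finite_bits_le: "finite {x::bits. length x \<le> N}"
  using finite_lists_length_le[of "UNIV :: bool set" N] by simp

text \<open>By surjectivity every string \<open>u\<close> of length \<open>M\<close> begins some
  image. The replaced prefix of that image has length at most \<open>M\<close>, hence is a prefix of
  \<open>u\<close>, and the inverse can act on it.\<close>

lemma inv_prefix_bijection: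
  assumes f: "f \<in> prefix_bijections"
  shows "inv_into UNIV f \<in> prefix_bijections"
proof -
  have bij: "bij f" by (rule prefix_bijection_bij[OF f])
  obtain N where N: "\<And>x. N \<le> length x \<Longrightarrow> \<exists>y. sends f x y"
    using prefix_bijection_sends[OF f] by metis
  define h where "h x = (SOME y. sends f x y)" for x
  have h: "sends f x (h x)" if "N \<le> length x" for x
    unfolding h_def using N[OF that] by (rule someI_ex)
  \<comment> \<open>Below length \<open>N\<close> the choice \<open>h\<close> may be arbitrary; this
    can only enlarge the maximum.\<close>
  define M where "M = Max ((length \<circ> h) ` {x. length x \<le> N})"
  have M: "length (h x) \<le> M" if "length x = N" for x
    unfolding M_def using finite_bits_le[of N] that by (intro Max_ge) auto
  have "\<exists>x. sends (inv_into UNIV f) u x" if u: "length u = M" for u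
  proof -
    obtain \<sigma> where \<sigma>: "f \<sigma> = u \<frown> (\<lambda>_. False)" using bij by (metis bij_pointE)
    define x where "x = prefix N \<sigma>"
    have len: "length x = N" unfolding x_def by simp
    have "f \<sigma> = h x \<frown> suffix N \<sigma>"
      using h[of x] len unfolding sends_def x_def by (metis order_refl prefix_suffix)
    then have "u = h x @ drop (length (h x)) u"
      using conc_eq_prefix(1)[of "h x" "suffix N \<sigma>" u "\<lambda>_. False"] \<sigma> M[OF len] u by simp
    moreover have "sends (inv_into UNIV f) (h x) x"
      using sends_inv[OF bij h] len by simp
    ultimately show ?thesis using sends_append by metis
  qed
  then show ?thesis
    unfolding prefix_bijections_def using bij_imp_bij_inv[OF bij] by blast
qed

section \<open>Finitely generated essential right ideals\<close>

lemma essential_of_long: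
  assumes "right_ideal R" and long: "\<And>x. N \<le> length x \<Longrightarrow> x \<in> R"
  shows "essential R" "finitely_generated R"
proof -
  have "R \<inter> S \<noteq> {}" if S: "right_ideal S" "S \<noteq> {}" for S
  proof -
    obtain x where "x \<in> S" using S(2) by blast
    then have "x @ replicate N False \<in> R \<inter> S"
      using S(1) long unfolding right_ideal_def by simp
    then show ?thesis by blast
  qed
  then show "essential R" unfolding essential_def using assms(1) by blast
  let ?F = "R \<inter> {x. length x \<le> N}"
  have "x \<in> {r @ z | r z. r \<in> ?F}" if "x \<in> R" for x
  proof (cases "length x \<le> N")
    case True
    then have "x = x @ [] \<and> x \<in> ?F" using that by simp
    then show ?thesis by blast
  next
    case False
    then have "x = take N x @ drop N x \<and> take N x \<in> ?F" using long[of "take N x"] by simp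
    then show ?thesis by blast
  qed
  then have "R = {r @ z | r z. r \<in> ?F}"
    using assms(1) unfolding right_ideal_def by blast
  moreover have "finite ?F" using finite_bits_le[of N] by blast
  ultimately show "finitely_generated R" unfolding finitely_generated_def by blast
qed

text \<open>Essentiality is applied to the ideal generated by \<open>x\<close>: a common element
  with \<open>R\<close> begins both with \<open>x\<close> and with a generator, and the generator is
  not the longer of the two.\<close>

lemma essential_long:
  assumes "essential R" "finitely_generated R"
  obtains N where "\<And>x. N \<le> length x \<Longrightarrow> x \<in> R"
proof -
  obtain F where F: "finite F" "R = {r @ z | r z. r \<in> F}"
    using assms(2) unfolding finitely_generated_def by blast
  obtain N where N: "\<And>r. r \<in> F \<Longrightarrow> length r \<le> N"
    using F(1) by (metis finite_imageI finite_nat_set_iff_bounded_le imageI)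
  have "x \<in> R" if x: "N \<le> length x" for x
  proof -
    have "right_ideal {x @ z | z. True}" unfolding right_ideal_def by auto
    then have "R \<inter> {x @ z | z. True} \<noteq> {}"
      using assms(1) unfolding essential_def by blast
    then obtain z r z' where z: "x @ z = r @ z'" "r \<in> F" using F(2) by blast
    then have "length r \<le> length x" using N x by force
    then have "x = r @ drop (length r) x"
      using z(1) by (metis append_eq_append_conv_if append_take_drop_id)
    then show ?thesis using F(2) z(2) by blast
  qed
  then show thesis using that by blast
qed

section \<open>Partial actions as elements of \<open>G21\<close>\<close>

lemma ideal_iso_partial_action:
  assumes "f \<in> prefix_bijections"
  shows "ideal_iso (dom (partial_action f)) (dom (partial_action (inv_into UNIV f))) (partial_action f)"
proof -
  have bij: "bij f" by (rule prefix_bijection_bij[OF assms])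
  have val: "the (partial_action h x) = y" if "sends h x y" for h x y
    using that by (metis option.sel partial_action_Some)
  have "bij_betw (\<lambda>r. the (partial_action f r)) {x. \<exists>y. sends f x y}
    {y. \<exists>x. sends (inv_into UNIV f) y x}"
  proof (rule bij_betw_byWitness[where f' = "\<lambda>r. the (partial_action (inv_into UNIV f) r)"])
    show "\<forall>a\<in>{x. \<exists>y. sends f x y}.
       the (partial_action (inv_into UNIV f) (the (partial_action f a))) = a"
      using val[of f] val[of "inv_into UNIV f"] sends_inv[OF bij] by auto
    show "\<forall>a'\<in>{y. \<exists>x. sends (inv_into UNIV f) y x}.
       the (partial_action f (the (partial_action (inv_into UNIV f) a'))) = a'"
      using val[of f] val[of "inv_into UNIV f"] sends_inv_iff[OF bij] by auto
    show "(\<lambda>r. the (partial_action f r)) ` {x. \<exists>y. sends f x y}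
        \<subseteq> {y. \<exists>x. sends (inv_into UNIV f) y x}"
      using val[of f] sends_inv[OF bij] by fastforce
    show "(\<lambda>r. the (partial_action (inv_into UNIV f) r)) ` {y. \<exists>x. sends (inv_into UNIV f) y x}
        \<subseteq> {x. \<exists>y. sends f x y}"
      using val[of "inv_into UNIV f"] sends_inv_iff[OF bij] by fastforce
  qed
  moreover have "right_ideal {x. \<exists>y. sends h x y}" for h
    unfolding right_ideal_def using sends_append by blast
  moreover have "the (partial_action f (r @ z)) = the (partial_action f r) @ z"
    if "sends f r y" for r y z
    using val[OF that] val[OF sends_append[OF that, of z]] by simp
  ultimately show ?thesis
    unfolding ideal_iso_def dom_partial_action by auto
qed

lemma fg_essential_partial_action:
  assumes "f \<in> prefix_bijections"
  shows "fg_essential_iso (partial_action f)"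
proof -
  have "essential (dom (partial_action h)) \<and> finitely_generated (dom (partial_action h))"
    if h: "h \<in> prefix_bijections" for h
  proof -
    obtain N where "\<And>x. N \<le> length x \<Longrightarrow> \<exists>y. sends h x y"
      using prefix_bijection_sends[OF h] by metis
    moreover have "right_ideal (dom (partial_action h))"
      using ideal_iso_partial_action[OF h] unfolding ideal_iso_def by blast
    ultimately show ?thesis
      using essential_of_long[of "dom (partial_action h)" N] dom_partial_action[of h] by auto
  qed
  then show ?thesis
    unfolding fg_essential_iso_def
    using assms inv_prefix_bijection[OF assms] ideal_iso_partial_action[OF assms] by blast
qed

lemma fg_essential_iso_essential: "fg_essential_iso \<phi> \<Longrightarrow> essential_iso \<phi>"
  unfolding fg_essential_iso_def essential_iso_def by blast

lemma essential_iso_append: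
  assumes "essential_iso \<phi>" "\<phi> x = Some y"
  shows "\<phi> (x @ z) = Some (y @ z)"
proof -
  obtain R S where "ideal_iso R S \<phi>" using assms(1) unfolding essential_iso_def by blast
  then have "right_ideal R" "dom \<phi> = R" "\<forall>r\<in>R. \<forall>z. the (\<phi> (r @ z)) = the (\<phi> r) @ z"
    unfolding ideal_iso_def by auto
  moreover have "x \<in> dom \<phi>" using assms(2) by blast
  ultimately have "x @ z \<in> dom \<phi>" "the (\<phi> (x @ z)) = y @ z"
    using assms(2) unfolding right_ideal_def by auto
  then show ?thesis by auto
qed

text \<open>\<open>f\<close> at \<open>x\<close> is tested on the long extensions of \<open>x\<close>, where \<open>\<psi>\<close> and \<open>f\<close> agree through \<open>\<chi>\<close>.\<close>

lemma essential_iso_le_partial_action: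
  assumes \<psi>: "essential_iso \<psi>" and le: "\<chi> \<subseteq>\<^sub>m \<psi>" "\<chi> \<subseteq>\<^sub>m partial_action f"
    and long: "\<And>x. N \<le> length x \<Longrightarrow> x \<in> dom \<chi>"
  shows "\<psi> \<subseteq>\<^sub>m partial_action f"
proof -
  have "partial_action f x = Some y" if xy: "\<psi> x = Some y" for x y
  proof -
    have "f (x \<frown> s) = y \<frown> s" for s
    proof -
      have "x @ prefix N s \<in> dom \<chi>" by (rule long) simp
      then have "\<chi> (x @ prefix N s) = Some (y @ prefix N s)"
        using le(1) essential_iso_append[OF \<psi> xy, of "prefix N s"] unfolding map_le_def by metis
      then have "sends f (x @ prefix N s) (y @ prefix N s)"
        using le(2) unfolding map_le_def by (metis domI partial_action_Some)
      then have "f ((x @ prefix N s) \<frown> suffix N s) = (y @ prefix N s) \<frown> suffix N s"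
        unfolding sends_def by blast
      then show ?thesis by (metis conc_conc prefix_suffix)
    qed
    then show ?thesis unfolding partial_action_Some sends_def by blast
  qed
  then show ?thesis unfolding map_le_def by (metis domD)
qed

lemma maximal_partial_action:
  assumes "f \<in> prefix_bijections"
  shows "maximal_iso (partial_action f)"
proof -
  obtain N where "\<And>x. N \<le> length x \<Longrightarrow> \<exists>y. sends f x y"
    using prefix_bijection_sends[OF assms] by metis
  then have "\<And>x. N \<le> length x \<Longrightarrow> x \<in> dom (partial_action f)"
    using dom_partial_action by blast
  then show ?thesis
    unfolding maximal_iso_def
    using essential_iso_le_partial_action[of _ "partial_action f" f N]
      fg_essential_iso_essential[OF fg_essential_partial_action[OF assms]]
    by (meson map_le_antisym map_le_refl)
qed

text \<open>A composite of maximal maps may fail to be maximal. Agreement on all sufficiently long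
  strings pins down its maximal extension and also supplies the uniqueness behind the definite
  description.\<close>

lemma max_ext_eq:
  assumes f: "f \<in> prefix_bijections" and le: "\<chi> \<subseteq>\<^sub>m partial_action f"
    and long: "\<And>x. N \<le> length x \<Longrightarrow> x \<in> dom \<chi>"
  shows "max_ext \<chi> = partial_action f"
  unfolding max_ext_def
proof (rule the_equality)
  show "maximal_iso (partial_action f) \<and> \<chi> \<subseteq>\<^sub>m partial_action f"
    using maximal_partial_action[OF f] le by blast
  fix \<psi> assume "maximal_iso \<psi> \<and> \<chi> \<subseteq>\<^sub>m \<psi>"
  then show "\<psi> = partial_action f"
    using essential_iso_le_partial_action[of \<psi> \<chi> f N] le long
      fg_essential_iso_essential[OF fg_essential_partial_action[OF f]]
    unfolding maximal_iso_def by metis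
qed

text \<open>The partial composite is undefined where \<open>g\<close> has too little input for its
  own replacement, although \<open>f \<circ> g\<close> may still send the string. Hence only
  inclusion is shown, together with definedness on long strings; \<open>max_ext_eq\<close> closes
  the gap.\<close>

lemma G21_mult:
  assumes f: "f \<in> prefix_bijections" and g: "g \<in> prefix_bijections"
  shows "partial_action f \<otimes>\<^bsub>G21\<^esub> partial_action g = partial_action (f \<circ> g)"
proof -
  obtain M where M: "\<And>x. M \<le> length x \<Longrightarrow> \<exists>y. sends f x y"
    using prefix_bijection_sends[OF f] by metis
  obtain N where N: "\<And>x. N \<le> length x \<Longrightarrow> \<exists>y. M \<le> length y \<and> sends g x y"
    using prefix_bijection_sends_long[OF g] by metis
  have "max_ext (partial_action f \<circ>\<^sub>m partial_action g) = partial_action (f \<circ> g)"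
  proof (rule max_ext_eq[OF comp_prefix_bijection[OF f g]])
    show "partial_action f \<circ>\<^sub>m partial_action g \<subseteq>\<^sub>m partial_action (f \<circ> g)"
      unfolding map_le_def
    proof
      fix x assume "x \<in> dom (partial_action f \<circ>\<^sub>m partial_action g)"
      then obtain z where z: "(partial_action f \<circ>\<^sub>m partial_action g) x = Some z" by blast
      then obtain y where "sends g x y" "sends f y z"
        by (auto simp: map_comp_Some_iff)
      then show "(partial_action f \<circ>\<^sub>m partial_action g) x = partial_action (f \<circ> g) x"
        using z sends_comp by (metis partial_action_Some)
    qed
    fix x :: bits assume "N \<le> length x"
    then obtain y where "M \<le> length y" "sends g x y" using N by blast
    moreover obtain z where "sends f y z" using M calculation by blast
    ultimately show "x \<in> dom (partial_action f \<circ>\<^sub>m partial_action g)"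
      by (auto simp: map_comp_Some_iff dom_def)
  qed
  then show ?thesis unfolding G21_def by simp
qed

text \<open>On the Cantor space \<open>\<phi>\<close> acts by rewriting the prefix of a fixed length
  \<open>N\<close> at which it is everywhere defined. Maximality turns the inclusion of
  \<open>\<phi>\<close> in the partial action of this map into equality.\<close>

lemma ex_partial_action:
  assumes \<phi>: "fg_essential_iso \<phi>" "maximal_iso \<phi>"
  shows "\<exists>f\<in>prefix_bijections. \<phi> = partial_action f"
proof -
  obtain R S where RS: "essential R" "finitely_generated R" "essential S" "finitely_generated S"
    "ideal_iso R S \<phi>" using \<phi>(1) unfolding fg_essential_iso_def by blast
  have dom: "dom \<phi> = R" and bij: "bij_betw (\<lambda>r. the (\<phi> r)) R S"
    using RS(5) unfolding ideal_iso_def by auto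
  obtain N where N: "\<And>x. N \<le> length x \<Longrightarrow> x \<in> R"
    using essential_long[OF RS(1,2)] by metis
  obtain M where M: "\<And>x. M \<le> length x \<Longrightarrow> x \<in> S"
    using essential_long[OF RS(3,4)] by metis
  have app: "\<phi> (x @ z) = Some (y @ z)" if "\<phi> x = Some y" for x y z
    using essential_iso_append[OF fg_essential_iso_essential[OF \<phi>(1)] that] .
  have inj: "x = x'" if "\<phi> x = Some y" "\<phi> x' = Some y" for x x' y
    using that bij dom unfolding bij_betw_def inj_on_def by (metis domI)
  \<comment> \<open>Of two images that start the same sequence the longer extends the shorter, so it
    is also the image of an extension of \<open>x\<close>, which must be \<open>x'\<close> by
    injectivity of \<open>\<phi>\<close>.\<close>
  have overlap: "x' \<frown> t' = x \<frown> t"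
    if "\<phi> x = Some y" "\<phi> x' = Some y'" "y \<frown> t = y' \<frown> t'" "length y \<le> length y'"
    for x x' y y' t t'
  proof -
    have y': "y @ drop (length y) y' = y'" and t: "t = drop (length y) y' \<frown> t'"
      using conc_eq_prefix[OF that(3,4)] by auto
    have "\<phi> (x @ drop (length y) y') = Some y'"
      using app[OF that(1), of "drop (length y) y'"] y' by simp
    then have "x' = x @ drop (length y) y'"
      using inj that(2) by blast
    then show ?thesis using t by simp
  qed
  define f :: "cantor \<Rightarrow> cantor" where "f s = the (\<phi> (prefix N s)) \<frown> suffix N s" for s
  \<comment> \<open>The action does not depend on the prefix length at which \<open>\<phi>\<close>
    is evaluated.\<close>
  have ev: "f (x \<frown> s) = y \<frown> s" if xy: "\<phi> x = Some y" for x y s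
  proof -
    have "prefix N (x \<frown> s) \<in> dom \<phi>" using N dom by simp
    then obtain u where u: "\<phi> (prefix N (x \<frown> s)) = Some u" by blast
    show ?thesis
    proof (cases "length x \<le> N")
      case True
      then have "u = y @ prefix (N - length x) s" using u app[OF xy] by simp
      moreover have "suffix N (x \<frown> s) = suffix (N - length x) s" using True by simp
      ultimately show ?thesis
        unfolding f_def u by (metis conc_conc option.sel prefix_suffix)
    next
      case False
      then have u': "\<phi> (take N x) = Some u" using u by simp
      have "y = u @ drop N x" using app[OF u', of "drop N x"] xy by simp
      then show ?thesis unfolding f_def u using False by simp
    qed
  qed
  have "inj f"
  proof
    fix s s' assume eq: "f s = f s'"
    have "prefix N s \<in> dom \<phi>" "prefix N s' \<in> dom \<phi>" using N dom by simp_all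
    then obtain u u' where u: "\<phi> (prefix N s) = Some u" "\<phi> (prefix N s') = Some u'" by blast
    have "u \<frown> suffix N s = u' \<frown> suffix N s'" using eq u unfolding f_def by simp
    then have "prefix N s \<frown> suffix N s = prefix N s' \<frown> suffix N s'"
      using overlap[OF u(1) u(2)] overlap[OF u(2) u(1)] by (metis nle_le)
    then show "s = s'" by (metis prefix_suffix)
  qed
  moreover have "surj f"
  proof -
    have "\<exists>s. f s = t" for t
    proof -
    have "prefix M t \<in> S" using M by simp
    then obtain x where "x \<in> R" "the (\<phi> x) = prefix M t" using bij unfolding bij_betw_def by auto
    then have "\<phi> x = Some (prefix M t)" using dom by auto
    then have "f (x \<frown> suffix M t) = t" using ev by (metis prefix_suffix)
    then show ?thesis by blast
    qed
    then show ?thesis unfolding surj_def by metis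
  qed
  moreover have snd: "sends f x y" if "\<phi> x = Some y" for x y
    using ev[OF that] unfolding sends_def by blast
  moreover have "\<exists>y. sends f x y" if "length x = N" for x
    using N[of x] that dom snd by blast
  ultimately have f: "f \<in> prefix_bijections"
    unfolding prefix_bijections_def bij_def by blast
  have "\<phi> \<subseteq>\<^sub>m partial_action f"
    unfolding map_le_def using snd by (metis domD partial_action_Some)
  then have "\<phi> = partial_action f"
    using \<phi>(2) fg_essential_iso_essential[OF fg_essential_partial_action[OF f]]
    unfolding maximal_iso_def by metis
  then show ?thesis using f by blast
qed

lemma carrier_G21: "carrier G21 = partial_action ` prefix_bijections"
  unfolding G21_def
  using ex_partial_action fg_essential_partial_action maximal_partial_action by auto

lemma partial_action_id: "partial_action id = \<one>\<^bsub>G21\<^esub>"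
proof
  fix x :: bits
  have "sends id x x" unfolding sends_def by simp
  then show "partial_action id x = \<one>\<^bsub>G21\<^esub> x" unfolding G21_def by simp
qed

text \<open>The axioms are inherited from composition of bijections through \<open>G21_mult\<close>,
  which avoids computing with nested maximal extensions.\<close>

lemma group_G21: "group G21"
proof (rule groupI)
  show "\<one>\<^bsub>G21\<^esub> \<in> carrier G21"
    unfolding carrier_G21 partial_action_id[symmetric] using id_prefix_bijection by blast
  fix x assume "x \<in> carrier G21"
  then obtain f where f: "f \<in> prefix_bijections" "x = partial_action f"
    unfolding carrier_G21 by blast
  show "\<one>\<^bsub>G21\<^esub> \<otimes>\<^bsub>G21\<^esub> x = x"
    using f G21_mult[OF id_prefix_bijection f(1)] by (simp add: partial_action_id)
  have "inv_into UNIV f \<circ> f = id"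
    using f(1) prefix_bijection_bij bij_is_inj by (metis inv_o_cancel)
  then show "\<exists>y\<in>carrier G21. y \<otimes>\<^bsub>G21\<^esub> x = \<one>\<^bsub>G21\<^esub>"
    using f inv_prefix_bijection[OF f(1)] G21_mult[OF inv_prefix_bijection[OF f(1)] f(1)]
    unfolding carrier_G21 by (metis imageI partial_action_id)
  fix y assume "y \<in> carrier G21"
  then obtain g where g: "g \<in> prefix_bijections" "y = partial_action g"
    unfolding carrier_G21 by blast
  show "x \<otimes>\<^bsub>G21\<^esub> y \<in> carrier G21"
    using f g G21_mult[OF f(1) g(1)] comp_prefix_bijection[OF f(1) g(1)]
    unfolding carrier_G21 by auto
  fix z assume "z \<in> carrier G21"
  then obtain h where h: "h \<in> prefix_bijections" "z = partial_action h"
    unfolding carrier_G21 by blast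
  show "x \<otimes>\<^bsub>G21\<^esub> y \<otimes>\<^bsub>G21\<^esub> z = x \<otimes>\<^bsub>G21\<^esub> (y \<otimes>\<^bsub>G21\<^esub> z)"
    using f g h by (simp add: G21_mult comp_prefix_bijection comp_assoc)
qed

lemma G21_inv:
  assumes "f \<in> prefix_bijections"
  shows "inv\<^bsub>G21\<^esub> partial_action f = partial_action (inv_into UNIV f)"
proof -
  interpret group G21 by (rule group_G21)
  have "inv_into UNIV f \<circ> f = id"
    using assms prefix_bijection_bij bij_is_inj by (metis inv_o_cancel)
  then have "partial_action (inv_into UNIV f) \<otimes>\<^bsub>G21\<^esub> partial_action f = \<one>\<^bsub>G21\<^esub>"
    using G21_mult[OF inv_prefix_bijection[OF assms] assms] partial_action_id by simp
  then show ?thesis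
    using inv_equality assms inv_prefix_bijection[OF assms] carrier_G21 by blast
qed

section \<open>Words and their cost\<close>

text \<open>\<open>n\<close> bounds the word length and \<open>K\<close> the subscripts of
  \<open>Tau\<close>; under composition the first bounds add up and the second is kept.\<close>

definition realizable :: "(bits \<rightharpoonup> bits) set \<Rightarrow> nat \<Rightarrow> nat \<Rightarrow> (cantor \<Rightarrow> cantor) \<Rightarrow> bool" where
  "realizable \<Gamma> K n f \<longleftrightarrow> f \<in> prefix_bijections \<and>
     (\<exists>W\<in>words_over \<Gamma>. word_value W = partial_action f \<and> length W \<le> n \<and>
       (\<forall>i s. (Tau i, s) \<in> set W \<longrightarrow> i \<le> K))"

section \<open>Adjacent transpositions as letters\<close>

lemma swap_eq_fun_upd: "(s :: cantor) \<circ> Transposition.transpose a b = s(a := s b, b := s a)"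
  by (auto simp: fun_eq_iff Transposition.transpose_def)

lemma sends_swap:
  assumes "a < length x" "b < length x"
  shows "sends (\<lambda>s. s \<circ> Transposition.transpose a b) x (x[a := x ! b, b := x ! a])"
  unfolding sends_def swap_eq_fun_upd using assms
  by (auto simp: fun_eq_iff conc_def nth_list_update)

lemma swap_prefix_bijection: "(\<lambda>s. s \<circ> Transposition.transpose a b) \<in> prefix_bijections"
proof -
  have "bij (\<lambda>s :: cantor. s \<circ> Transposition.transpose a b)"
    by (rule o_bij[of "\<lambda>s. s \<circ> Transposition.transpose a b"]) (auto simp: fun_eq_iff)
  moreover have "\<forall>x. length x = Suc (max a b) \<longrightarrow>
      (\<exists>y. sends (\<lambda>s. s \<circ> Transposition.transpose a b) x y)"
    using sends_swap[of a _ b] by (metis less_Suc_eq_le max.cobounded1 max.cobounded2)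
  ultimately show ?thesis unfolding prefix_bijections_def by blast
qed

text \<open>If \<open>x\<close> ends before position \<open>b\<close>, the output at
  \<open>b\<close> would have to follow the tail, but it receives the bit of position
  \<open>a\<close>. This keeps short strings out of the domain.\<close>

lemma not_sends_swap:
  assumes "a < b" "length x \<le> b"
  shows "\<not> sends (\<lambda>s. s \<circ> Transposition.transpose a b) x y"
proof
  assume snd: "sends (\<lambda>s. s \<circ> Transposition.transpose a b) x y"
  have ev: "((x \<frown> s) \<circ> Transposition.transpose a b) n = (y \<frown> s) n" for s n
    using snd unfolding sends_def by metis
  \<comment> \<open>A tail with a single one. At a position beyond all moved ones it shows that
    \<open>x\<close> and \<open>y\<close> have equal length; placed at \<open>b\<close> or just
    after \<open>b\<close>, it changes the output at \<open>b\<close> but not the input at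
    \<open>a\<close>.\<close>
  define S where "S k = (\<lambda>n :: nat. n = k)" for k
  let ?n = "Suc b + length y"
  have "(x \<frown> S (?n - length x)) ?n = (y \<frown> S (?n - length x)) ?n"
    using ev[of "S (?n - length x)" ?n] assms by (simp add: Transposition.transpose_def)
  then have len: "length y = length x"
    using assms unfolding S_def by (simp add: conc_def split: if_splits)
  let ?k = "b - length x"
  have "(x \<frown> S ?k) a = (y \<frown> S ?k) b" "(x \<frown> S (Suc ?k)) a = (y \<frown> S (Suc ?k)) b"
    using ev[of "S ?k" b] ev[of "S (Suc ?k)" b] by simp_all
  moreover have "(y \<frown> S ?k) b" "\<not> (y \<frown> S (Suc ?k)) b"
    using len assms unfolding S_def by (simp_all add: conc_def)
  moreover have "(x \<frown> S ?k) a \<longleftrightarrow> a < length x \<and> x ! a"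
    using assms unfolding S_def by (simp add: conc_def, arith)
  moreover have "(x \<frown> S (Suc ?k)) a \<longleftrightarrow> a < length x \<and> x ! a"
    using assms unfolding S_def by (simp add: conc_def, arith)
  ultimately show False by simp
qed

text \<open>\<open>bit_transposition\<close> counts from 1 and the Cantor space from 0, so subscript
  \<open>Suc a\<close> belongs to positions \<open>a\<close> and \<open>Suc a\<close>. Equality of
  the domains rests on \<open>not_sends_swap\<close>.\<close>

lemma bit_transposition_eq:
  "bit_transposition (Suc a) (Suc a + 1) = partial_action (\<lambda>s. s \<circ> Transposition.transpose a (Suc a))"
proof
  fix x
  show "bit_transposition (Suc a) (Suc a + 1) x =
    partial_action (\<lambda>s. s \<circ> Transposition.transpose a (Suc a)) x"
  proof (cases "Suc a < length x")
    case True
    then have "partial_action (\<lambda>s. s \<circ> Transposition.transpose a (Suc a)) x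
      = Some (x[a := x ! Suc a, Suc a := x ! a])"
      using sends_swap[of a x "Suc a"] by simp
    moreover have "bit_transposition (Suc a) (Suc a + 1) x = Some (x[a := x ! Suc a, Suc a := x ! a])"
      using True unfolding bit_transposition_def by simp
    ultimately show ?thesis by (rule trans[OF _ sym, rotated])
  next
    case False
    then have "partial_action (\<lambda>s. s \<circ> Transposition.transpose a (Suc a)) x = None"
      using not_sends_swap[of a "Suc a" x] unfolding partial_action_def by simp
    then show ?thesis using False unfolding bit_transposition_def by simp
  qed
qed

lemma realizable_swap:
  assumes "Suc a \<le> K"
  shows "realizable \<Gamma> K 1 (\<lambda>s. s \<circ> Transposition.transpose a (Suc a))"
proof -
  let ?f = "\<lambda>s :: cantor. s \<circ> Transposition.transpose a (Suc a)"
  have "word_value [(Tau (Suc a), True)] = partial_action ?f \<otimes>\<^bsub>G21\<^esub> \<one>\<^bsub>G21\<^esub>"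
    unfolding word_value_def signed_value_def using bit_transposition_eq[of a] by simp
  also have "\<dots> = partial_action ?f"
    using G21_mult[OF swap_prefix_bijection id_prefix_bijection] partial_action_id by simp
  finally have "word_value [(Tau (Suc a), True)] = partial_action ?f" .
  moreover have "[(Tau (Suc a), True)] \<in> words_over \<Gamma>" unfolding words_over_def by auto
  ultimately show ?thesis
    unfolding realizable_def using swap_prefix_bijection assms
    by (auto intro!: bexI[of _ "[(Tau (Suc a), True)]"])
qed

lemma realizable_id: "realizable \<Gamma> K n id"
  unfolding realizable_def using id_prefix_bijection partial_action_id
  by (auto intro!: bexI[of _ "[]"] simp: word_value_def words_over_def)

section \<open>Evaluation and formal inverses of words\<close>

lemma letter_value_closed:
  assumes "\<Gamma> \<subseteq> carrier G21" "l \<in> Gen ` \<Gamma> \<union> Tau ` {1..}"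
  shows "letter_value l \<in> carrier G21"
proof (cases l)
  case (Gen \<phi>)
  then show ?thesis using assms by auto
next
  case (Tau i)
  then obtain a where "i = Suc a" using assms(2) by (cases i) auto
  then show ?thesis
    using Tau bit_transposition_eq[of a] swap_prefix_bijection carrier_G21 by auto
qed

lemma signed_value_closed:
  assumes "\<Gamma> \<subseteq> carrier G21" "l \<in> Gen ` \<Gamma> \<union> Tau ` {1..}"
  shows "signed_value (l, s) \<in> carrier G21"
proof -
  interpret group G21 by (rule group_G21)
  show ?thesis unfolding signed_value_def using letter_value_closed[OF assms] by simp
qed

lemma words_over_Cons:
  "(p # W) \<in> words_over \<Gamma> \<longleftrightarrow> fst p \<in> Gen ` \<Gamma> \<union> Tau ` {1..} \<and> W \<in> words_over \<Gamma>"
  unfolding words_over_def by (cases p) auto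

lemma words_over_append: "V @ W \<in> words_over \<Gamma> \<longleftrightarrow> V \<in> words_over \<Gamma> \<and> W \<in> words_over \<Gamma>"
  unfolding words_over_def by simp

lemma word_value_simps:
  "word_value [] = \<one>\<^bsub>G21\<^esub>" "word_value (l # W) = signed_value l \<otimes>\<^bsub>G21\<^esub> word_value W"
  unfolding word_value_def by simp_all

lemma word_value_closed:
  assumes "\<Gamma> \<subseteq> carrier G21" "W \<in> words_over \<Gamma>"
  shows "word_value W \<in> carrier G21"
proof -
  interpret group G21 by (rule group_G21)
  show ?thesis using assms(2)
  proof (induction W)
    case (Cons p W)
    then show ?case
      using signed_value_closed[OF assms(1), of "fst p" "snd p"]
      by (simp add: words_over_Cons word_value_simps)
  qed (simp add: word_value_simps)
qed

lemma word_value_append: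
  assumes "\<Gamma> \<subseteq> carrier G21" "V \<in> words_over \<Gamma>" "W \<in> words_over \<Gamma>"
  shows "word_value (V @ W) = word_value V \<otimes>\<^bsub>G21\<^esub> word_value W"
proof -
  interpret group G21 by (rule group_G21)
  show ?thesis using assms(2)
  proof (induction V)
    case (Cons p V)
    then show ?case
      using signed_value_closed[OF assms(1), of "fst p" "snd p"] word_value_closed[OF assms(1)] assms(3)
      by (simp add: words_over_Cons word_value_simps m_assoc)
  qed (simp add: word_value_simps word_value_closed[OF assms(1,3)])
qed

lemma word_inverse_Cons: "word_inverse ((l, s) # W) = word_inverse W @ [(l, \<not> s)]"
  unfolding word_inverse_def by simp

lemma length_word_inverse: "length (word_inverse W) = length W"
  unfolding word_inverse_def by simp

lemma set_word_inverse: "(l, s) \<in> set (word_inverse W) \<longleftrightarrow> (l, \<not> s) \<in> set W"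
  unfolding word_inverse_def by force

lemma word_inverse_closed: "W \<in> words_over \<Gamma> \<Longrightarrow> word_inverse W \<in> words_over \<Gamma>"
  unfolding words_over_def word_inverse_def by auto

lemma word_value_inverse:
  assumes "\<Gamma> \<subseteq> carrier G21" "W \<in> words_over \<Gamma>"
  shows "word_value (word_inverse W) = inv\<^bsub>G21\<^esub> word_value W"
proof -
  interpret group G21 by (rule group_G21)
  show ?thesis using assms(2)
  proof (induction W)
    case Nil
    then show ?case by (simp add: word_value_simps word_inverse_def)
  next
    case (Cons p W)
    obtain l s where p: "p = (l, s)" by force
    have l: "l \<in> Gen ` \<Gamma> \<union> Tau ` {1..}" and W: "W \<in> words_over \<Gamma>"
      using Cons.prems p by (simp_all add: words_over_Cons)
    have "signed_value (l, \<not> s) = inv\<^bsub>G21\<^esub> signed_value (l, s)"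
      unfolding signed_value_def using letter_value_closed[OF assms(1) l] by simp
    moreover have "[(l, \<not> s)] \<in> words_over \<Gamma>"
      using l by (simp add: words_over_Cons) (simp add: words_over_def)
    ultimately show ?case
      using Cons.IH[OF W] word_value_append[OF assms(1) word_inverse_closed[OF W]]
        word_value_closed[OF assms(1) W] signed_value_closed[OF assms(1) l]
      by (simp add: p word_inverse_Cons word_value_simps inv_mult_group)
  qed
qed

section \<open>Costs of composites, inverses and fixed elements\<close>

lemma realizable_comp:
  assumes "\<Gamma> \<subseteq> carrier G21" "realizable \<Gamma> K a f" "realizable \<Gamma> K b g"
  shows "realizable \<Gamma> K (a + b) (f \<circ> g)"
proof -
  obtain V where V: "V \<in> words_over \<Gamma>" "word_value V = partial_action f" "length V \<le> a"
    "\<And>i s. (Tau i, s) \<in> set V \<Longrightarrow> i \<le> K" and f: "f \<in> prefix_bijections"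
    using assms(2) unfolding realizable_def by blast
  obtain W where W: "W \<in> words_over \<Gamma>" "word_value W = partial_action g" "length W \<le> b"
    "\<And>i s. (Tau i, s) \<in> set W \<Longrightarrow> i \<le> K" and g: "g \<in> prefix_bijections"
    using assms(3) unfolding realizable_def by blast
  have "word_value (V @ W) = partial_action (f \<circ> g)"
    using word_value_append[OF assms(1) V(1) W(1)] V(2) W(2) G21_mult[OF f g] by simp
  moreover have "V @ W \<in> words_over \<Gamma>" using V(1) W(1) by (simp add: words_over_append)
  moreover have "length (V @ W) \<le> a + b" using V(3) W(3) by simp
  moreover have "\<forall>i s. (Tau i, s) \<in> set (V @ W) \<longrightarrow> i \<le> K" using V(4) W(4) by auto
  ultimately show ?thesis
    unfolding realizable_def using comp_prefix_bijection[OF f g] by blast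
qed

lemma realizable_inv:
  assumes "\<Gamma> \<subseteq> carrier G21" "realizable \<Gamma> K n f"
  shows "realizable \<Gamma> K n (inv_into UNIV f)"
proof -
  obtain W where W: "W \<in> words_over \<Gamma>" "word_value W = partial_action f" "length W \<le> n"
    "\<And>i s. (Tau i, s) \<in> set W \<Longrightarrow> i \<le> K" and f: "f \<in> prefix_bijections"
    using assms(2) unfolding realizable_def by blast
  have "word_value (word_inverse W) = partial_action (inv_into UNIV f)"
    using word_value_inverse[OF assms(1) W(1)] W(2) G21_inv[OF f] by simp
  then show ?thesis
    unfolding realizable_def
    using inv_prefix_bijection[OF f] word_inverse_closed[OF W(1)] W(3,4)
    by (auto intro!: bexI[of _ "word_inverse W"] simp: length_word_inverse set_word_inverse)
qed

lemma realizable_mono: "realizable \<Gamma> K a f \<Longrightarrow> a \<le> b \<Longrightarrow> realizable \<Gamma> K b f"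
  unfolding realizable_def by (meson order_trans)

lemma realizable_funpow:
  assumes "\<Gamma> \<subseteq> carrier G21" "realizable \<Gamma> K a f"
  shows "realizable \<Gamma> K (n * a) (f ^^ n)"
proof (induction n)
  case 0
  then show ?case using realizable_id[of \<Gamma> K 0] by (simp add: id_def)
next
  case (Suc n)
  then show ?case using realizable_comp[OF assms(1,2) Suc] by (simp only: funpow.simps mult_Suc)
qed

lemma generate_word:
  assumes "\<Gamma> \<subseteq> carrier G21" "\<phi> \<in> generate G21 \<Gamma>"
  shows "\<exists>W\<in>words_over \<Gamma>. word_value W = \<phi> \<and> (\<forall>i s. (Tau i, s) \<notin> set W)"
proof -
  interpret group G21 by (rule group_G21)
  have single: "\<exists>W\<in>words_over \<Gamma>. word_value W = signed_value (Gen h, b) \<and> (\<forall>i s. (Tau i, s) \<notin> set W)"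
    if "h \<in> \<Gamma>" for h b
    using that signed_value_closed[OF assms(1), of "Gen h" b]
    by (intro bexI[of _ "[(Gen h, b)]"]) (auto simp: word_value_simps words_over_def)
  show ?thesis using assms(2)
  proof (induction rule: generate.induct)
    case one
    show ?case by (intro bexI[of _ "[]"]) (auto simp: word_value_simps words_over_def)
  next
    case (incl h)
    then show ?case using single[of h True] by (simp add: signed_value_def)
  next
    case (inv h)
    then show ?case using single[of h False] by (simp add: signed_value_def)
  next
    case (eng h1 h2)
    then obtain V W where "V \<in> words_over \<Gamma>" "W \<in> words_over \<Gamma>" "word_value V = h1" "word_value W = h2"
      "\<forall>i s. (Tau i, s) \<notin> set V" "\<forall>i s. (Tau i, s) \<notin> set W" by blast
    then show ?case
      using word_value_append[OF assms(1)]
      by (intro bexI[of _ "V @ W"]) (auto simp: words_over_append)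
  qed
qed

text \<open>The word consists of \<open>Gen\<close> letters only, so one length bound is valid for
  every \<open>K\<close>: a fixed element has constant cost.\<close>

lemma realizable_const:
  assumes "\<Gamma> \<subseteq> carrier G21" "generate G21 \<Gamma> = carrier G21" "f \<in> prefix_bijections"
  shows "\<exists>n. \<forall>K. realizable \<Gamma> K n f"
proof -
  have "partial_action f \<in> generate G21 \<Gamma>" using assms(2,3) carrier_G21 by blast
  then obtain W where "W \<in> words_over \<Gamma>" "word_value W = partial_action f" "\<forall>i s. (Tau i, s) \<notin> set W"
    using generate_word[OF assms(1)] by blast
  then show ?thesis unfolding realizable_def using assms(3) by blast
qed

section \<open>Routing by adjacent transpositions\<close>

lemma realizable_move:
  assumes \<Gamma>: "\<Gamma> \<subseteq> carrier G21" and p: "a \<le> p" "p \<le> K"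
  shows "\<exists>\<pi>. \<pi> permutes {a..K} \<and> \<pi> a = p \<and> realizable \<Gamma> K (p - a) (\<lambda>s. s \<circ> \<pi>)"
  using p
proof (induction p rule: dec_induct)
  case base
  show ?case using realizable_id[of \<Gamma> K 0] by (intro exI[of _ id]) (simp add: permutes_id flip: id_def)
next
  case (step p)
  then obtain \<pi> where \<pi>: "\<pi> permutes {a..K}" "\<pi> a = p" "realizable \<Gamma> K (p - a) (\<lambda>s. s \<circ> \<pi>)"
    using Suc_leD by blast
  \<comment> \<open>Precomposition reverses the order: the bit at \<open>Suc p\<close> is first
    brought to \<open>p\<close> and then on to \<open>a\<close>.\<close>
  let ?t = "Transposition.transpose p (Suc p)"
  have "?t permutes {a..K}" using step by (intro permutes_swap_id) auto
  then have "(?t \<circ> \<pi>) permutes {a..K}" using \<pi>(1) permutes_compose by blast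
  moreover have "(?t \<circ> \<pi>) a = Suc p" using \<pi>(2) by simp
  moreover have "realizable \<Gamma> K (p - a + 1) ((\<lambda>s. s \<circ> \<pi>) \<circ> (\<lambda>s. s \<circ> ?t))"
    using realizable_comp[OF \<Gamma> \<pi>(3) realizable_swap] step by simp
  moreover have "(\<lambda>s :: cantor. s \<circ> \<pi>) \<circ> (\<lambda>s. s \<circ> ?t) = (\<lambda>s. s \<circ> (?t \<circ> \<pi>))"
    by (simp add: fun_eq_iff)
  moreover have "p - a + 1 = Suc p - a" using step by simp
  ultimately show ?case by metis
qed

text \<open>The bits are fetched one at a time. Fetching \<open>p\<close> displaces the others to
  the images of their positions under the inverse of \<open>\<pi>\<close>, so the recursion runs on
  the mapped list from \<open>Suc a\<close> on; hence induction on the length. Later moves fix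
  position \<open>a\<close>.\<close>

lemma realizable_route:
  assumes \<Gamma>: "\<Gamma> \<subseteq> carrier G21" and "distinct ps" "set ps \<subseteq> {a..K}"
  shows "\<exists>\<pi>. \<pi> permutes {a..K} \<and> (\<forall>i<length ps. \<pi> (a + i) = ps ! i) \<and>
    realizable \<Gamma> K (length ps * K) (\<lambda>s. s \<circ> \<pi>)"
  using assms(2,3)
proof (induction ps arbitrary: a rule: measure_induct_rule[of length])
  case (less qs)
  show ?case
  proof (cases qs)
    case Nil
    then show ?thesis
      using realizable_id[of \<Gamma> K 0] by (intro exI[of _ id]) (simp add: permutes_id flip: id_def)
  next
    case (Cons p ps)
    have prems: "distinct (p # ps)" "set (p # ps) \<subseteq> {a..K}" using less.prems Cons by simp_all
    then have "a \<le> p" "p \<le> K" by simp_all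
    then obtain \<pi> where \<pi>: "\<pi> permutes {a..K}" "\<pi> a = p" "realizable \<Gamma> K (p - a) (\<lambda>s. s \<circ> \<pi>)"
      using realizable_move[OF \<Gamma>] by blast
    have bij: "bij \<pi>" by (rule permutes_bij[OF \<pi>(1)])
    let ?q = "inv_into UNIV \<pi>"
    have q: "?q permutes {a..K}" by (rule permutes_inv[OF \<pi>(1)])
    have "distinct (map ?q ps)"
      using prems(1) inj_on_subset[OF bij_is_inj[OF bij_imp_bij_inv[OF bij]] subset_UNIV]
      by (simp add: distinct_map)
    moreover have "set (map ?q ps) \<subseteq> {Suc a..K}"
    proof
      fix r assume "r \<in> set (map ?q ps)"
      then obtain r' where r': "r' \<in> set ps" "r = ?q r'" by auto
      then have "r \<in> {a..K}" using prems(2) permutes_in_image[OF q] by auto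
      moreover have "r \<noteq> a" using r' \<pi>(2) prems(1) bij by (metis bij_inv_eq_iff distinct.simps(2))
      ultimately show "r \<in> {Suc a..K}" by simp
    qed
    ultimately have "\<exists>\<rho>. \<rho> permutes {Suc a..K} \<and>
        (\<forall>i<length (map ?q ps). \<rho> (Suc a + i) = map ?q ps ! i) \<and>
        realizable \<Gamma> K (length (map ?q ps) * K) (\<lambda>s. s \<circ> \<rho>)"
      using Cons by (intro less.IH) simp_all
    then obtain \<rho> where \<rho>: "\<rho> permutes {Suc a..K}" "\<forall>i<length ps. \<rho> (Suc a + i) = map ?q ps ! i"
      "realizable \<Gamma> K (length ps * K) (\<lambda>s. s \<circ> \<rho>)"
      unfolding length_map by blast
    have "(\<pi> \<circ> \<rho>) permutes {a..K}"
      by (rule permutes_compose[OF permutes_subset[OF \<rho>(1)] \<pi>(1)]) auto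
    moreover have "(\<pi> \<circ> \<rho>) (a + i) = (p # ps) ! i" if "i < length (p # ps)" for i
    proof (cases i)
      case 0
      then show ?thesis using \<pi>(2) permutes_not_in[OF \<rho>(1)] by simp
    next
      case (Suc j)
      then have "\<rho> (a + i) = ?q (ps ! j)" using \<rho>(2) that by simp
      then show ?thesis using Suc bij by (simp add: bij_is_surj surj_f_inv_f)
    qed
    moreover have "realizable \<Gamma> K (length qs * K) (\<lambda>s. s \<circ> (\<pi> \<circ> \<rho>))"
    proof -
      have "realizable \<Gamma> K (length ps * K + (p - a)) ((\<lambda>s. s \<circ> \<rho>) \<circ> (\<lambda>s. s \<circ> \<pi>))"
        using realizable_comp[OF \<Gamma> \<rho>(3) \<pi>(3)] .
      moreover have "(\<lambda>s :: cantor. s \<circ> \<rho>) \<circ> (\<lambda>s. s \<circ> \<pi>) = (\<lambda>s. s \<circ> (\<pi> \<circ> \<rho>))"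
        by (simp add: fun_eq_iff)
      moreover have "length ps * K + (p - a) \<le> length qs * K" using Cons \<open>p \<le> K\<close> by simp
      ultimately show ?thesis using realizable_mono by metis
    qed
    ultimately show ?thesis unfolding Cons by blast
  qed
qed

section \<open>Reversible programs\<close>

text \<open>Prefix replacement \<open>0 \<mapsto> 00\<close>, \<open>10 \<mapsto> 01\<close>, \<open>11 \<mapsto> 1\<close>.\<close>

definition create :: "cantor \<Rightarrow> cantor" where
  "create s = (if s 0 then if s 1 then suffix 1 s else [False, True] \<frown> suffix 2 s
               else [False] \<frown> s)"

lemma create_prefix_bijection: "create \<in> prefix_bijections"
proof -
  \<comment> \<open>The inverse replacement: 1 to 11, 01 to 10, 00 to 0.\<close>
  let ?d = "\<lambda>s :: cantor. if s 0 then [True] \<frown> s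
    else if s 1 then [True, False] \<frown> suffix 2 s else suffix 1 s"
  have "bij create"
  proof (rule o_bij[of ?d])
    show "?d \<circ> create = id"
    proof (rule ext, rule ext)
      show "(?d \<circ> create) s n = id s n" for s n
        by (cases n; cases "n - 1")
          (auto simp: create_def conc_def nth_Cons' numeral_2_eq_2 simp del: build_cons)
    qed
    show "create \<circ> ?d = id"
    proof (rule ext, rule ext)
      show "(create \<circ> ?d) s n = id s n" for s n
        by (cases n; cases "n - 1")
          (auto simp: create_def conc_def nth_Cons' numeral_2_eq_2 simp del: build_cons)
    qed
  qed
  moreover have "\<exists>y. sends create x y" if len: "length x = 2" for x
  proof -
    obtain a b where "x = [a, b]" using len by (auto simp: numeral_2_eq_2 length_Suc_conv)
    moreover have "sends create [a, b]
      (if a then if b then [True] else [False, True] else [False, False, b])"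
      unfolding sends_def create_def
      by (auto simp: fun_eq_iff conc_def nth_Cons' numeral_2_eq_2 simp del: build_cons)
    ultimately show ?thesis by blast
  qed
  ultimately show ?thesis unfolding prefix_bijections_def by blast
qed

lemma create_funpow:
  "(create ^^ n) ((False # x) \<frown> t) = (replicate (Suc n) False @ x) \<frown> t"
proof (induction n)
  case (Suc n)
  have "create ((replicate (Suc n) False @ x) \<frown> t) = [False] \<frown> ((replicate (Suc n) False @ x) \<frown> t)"
    unfolding create_def by simp
  then show ?case using Suc by simp
qed simp

section \<open>Exclusive-or instructions\<close>

type_synonym instruction = "nat \<times> nat \<times> nat \<times> (bool \<Rightarrow> bool \<Rightarrow> bool)"

fun exec :: "instruction \<Rightarrow> cantor \<Rightarrow> cantor" where
  "exec (p, q, r, h) s = s(p := (s p \<noteq> h (s q) (s r)))"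

text \<open>Separating the target from both sources makes every instruction an involution. Equal
  sources stay allowed, which covers unary gates and copying.\<close>

fun legal :: "nat set \<Rightarrow> instruction \<Rightarrow> bool" where
  "legal R (p, q, r, h) \<longleftrightarrow> p \<in> R \<and> q \<in> R \<and> r \<in> R \<and> p \<noteq> q \<and> p \<noteq> r"

lemma exec_exec: "legal R i \<Longrightarrow> exec i (exec i s) = s"
  by (cases i) (auto simp: fun_eq_iff)

lemma exec_prefix_bijection:
  assumes "legal R i"
  shows "exec i \<in> prefix_bijections"
proof -
  obtain p q r h where i: "i = (p, q, r, h)" by (cases i)
  have "bij (exec i)" by (rule o_bij[of "exec i"]) (auto simp: exec_exec[OF assms])
  moreover have "sends (exec i) x (x[p := (x ! p \<noteq> h (x ! q) (x ! r))])"
    if "length x = Suc (p + q + r)" for x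
    unfolding sends_def using that assms by (auto simp: i fun_eq_iff conc_def)
  ultimately show ?thesis unfolding prefix_bijections_def by blast
qed

text \<open>There are only sixteen truth tables \<open>h\<close>, so the largest of their costs is a
  common constant.\<close>

lemma realizable_exec_front:
  assumes "\<Gamma> \<subseteq> carrier G21" "generate G21 \<Gamma> = carrier G21"
  shows "\<exists>c. \<forall>h K. realizable \<Gamma> K c (exec (1, 2, 3, h))"
proof -
  have "exec (1, 2, 3, h) \<in> prefix_bijections" for h
    using exec_prefix_bijection[of UNIV "(1, 2, 3, h)"] by simp
  then have "\<forall>h. \<exists>n. \<forall>K. realizable \<Gamma> K n (exec (1, 2, 3, h))"
    using realizable_const[OF assms] by blast
  from choice[OF this] obtain d where d: "\<And>h K. realizable \<Gamma> K (d h) (exec (1, 2, 3, h))"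
    by blast
  have "d h \<le> Max (range d)" for h by (rule Max_ge) auto
  then show ?thesis using d realizable_mono by blast
qed

text \<open>Conjugation: the registers are routed to the front, a fixed instruction acts there, and
  the inverse routing puts everything back. If \<open>q = r\<close>, position 3 carries an
  unspecified bit, which \<open>h'\<close> ignores.\<close>

lemma realizable_exec:
  assumes \<Gamma>: "\<Gamma> \<subseteq> carrier G21" and c: "\<And>h. realizable \<Gamma> K c (exec (1, 2, 3, h))"
    and i: "legal {1..K} i"
  shows "realizable \<Gamma> K (6 * K + c) (exec i)"
proof -
  obtain p q r h where i_eq: "i = (p, q, r, h)" by (cases i)
  \<comment> \<open>\<open>q = r\<close> is allowed, but routing needs distinct positions\<close>
  define ps where "ps = (if q = r then [p, q] else [p, q, r])"
  define h' where "h' = (if q = r then (\<lambda>a b. h a a) else h)"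
  have "distinct ps" "set ps \<subseteq> {1..K}" using i unfolding i_eq ps_def by auto
  then obtain \<pi> where \<pi>: "\<pi> permutes {1..K}" "\<And>k. k < length ps \<Longrightarrow> \<pi> (1 + k) = ps ! k"
    "realizable \<Gamma> K (length ps * K) (\<lambda>s. s \<circ> \<pi>)"
    using realizable_route[OF \<Gamma>] by blast
  have bij: "bij \<pi>" by (rule permutes_bij[OF \<pi>(1)])
  have \<pi>p: "\<pi> 1 = p" and \<pi>q: "\<pi> 2 = q" and \<pi>r: "q \<noteq> r \<Longrightarrow> \<pi> 3 = r"
    using \<pi>(2)[of 0] \<pi>(2)[of 1] \<pi>(2)[of 2] unfolding ps_def
    by (auto simp: numeral_2_eq_2 numeral_3_eq_3 split: if_splits)
  have route: "realizable \<Gamma> K (3 * K) (\<lambda>s. s \<circ> \<pi>)"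
    using realizable_mono[OF \<pi>(3), of "3 * K"] unfolding ps_def by (simp split: if_splits)
  have bij': "bij (\<lambda>s :: cantor. s \<circ> \<pi>)"
    using \<pi>(3) prefix_bijection_bij unfolding realizable_def by blast
  have "exec i = inv_into UNIV (\<lambda>s. s \<circ> \<pi>) \<circ> (exec (1, 2, 3, h') \<circ> (\<lambda>s. s \<circ> \<pi>))"
  proof
    fix s
    have "exec i s \<circ> \<pi> = exec (1, 2, 3, h') (s \<circ> \<pi>)"
    proof
      fix n
      have "\<pi> n = p \<longleftrightarrow> n = 1" using \<pi>p bij by (metis bij_pointE)
      then show "(exec i s \<circ> \<pi>) n = exec (1, 2, 3, h') (s \<circ> \<pi>) n"
        using \<pi>p \<pi>q \<pi>r by (auto simp: i_eq h'_def)
    qed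
    then show "exec i s = (inv_into UNIV (\<lambda>s. s \<circ> \<pi>) \<circ> (exec (1, 2, 3, h') \<circ> (\<lambda>s. s \<circ> \<pi>))) s"
      using inv_f_f[OF bij_is_inj[OF bij'], of "exec i s"] by simp
  qed
  moreover have "realizable \<Gamma> K (3 * K + (c + 3 * K))
      (inv_into UNIV (\<lambda>s. s \<circ> \<pi>) \<circ> (exec (1, 2, 3, h') \<circ> (\<lambda>s. s \<circ> \<pi>)))"
    by (intro realizable_comp realizable_inv \<Gamma> c route)
  moreover have "3 * K + (c + 3 * K) = 6 * K + c" by simp
  ultimately show ?thesis by metis
qed

lemma realizable_program:
  assumes \<Gamma>: "\<Gamma> \<subseteq> carrier G21" and c: "\<And>h. realizable \<Gamma> K c (exec (1, 2, 3, h))"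
    and "\<And>i. i \<in> set ops \<Longrightarrow> legal {1..K} i"
  shows "realizable \<Gamma> K (length ops * (6 * K + c)) (fold exec ops)"
  using assms(3)
proof (induction ops)
  case Nil
  then show ?case using realizable_id[of \<Gamma> K 0] by (simp add: id_def)
next
  case (Cons i ops)
  then have "realizable \<Gamma> K (length ops * (6 * K + c) + (6 * K + c)) (fold exec ops \<circ> exec i)"
    using realizable_comp[OF \<Gamma> _ realizable_exec[OF \<Gamma> c]] by simp
  then show ?case by (simp add: add.commute comp_def)
qed

lemma fold_exec_other:
  assumes "\<And>i. i \<in> set ops \<Longrightarrow> fst i \<noteq> r"
  shows "fold exec ops s r = s r"
  using assms
proof (induction ops arbitrary: s)
  case (Cons i ops)
  then have "fst i \<noteq> r" "fold exec ops (exec i s) r = exec i s r" by simp_all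
  then show ?case by (cases i) simp
qed simp

lemma fold_exec_rev:
  assumes "\<And>i. i \<in> set ops \<Longrightarrow> legal R i"
  shows "fold exec (rev ops) (fold exec ops s) = s"
  using assms by (induction ops arbitrary: s) (simp_all add: exec_exec[of R])

text \<open>An instruction over \<open>R\<close> neither reads nor writes \<open>B\<close>. A result
  stored in \<open>B\<close> therefore survives when a computation over \<open>R\<close> is run
  backwards.\<close>

lemma exec_override_on:
  assumes "legal R i" "R \<inter> B = {}"
  shows "exec i (override_on s t B) = override_on (exec i s) t B"
  using assms by (cases i) (auto simp: fun_eq_iff override_on_def)

lemma fold_exec_override_on:
  assumes "\<And>i. i \<in> set ops \<Longrightarrow> legal R i" "R \<inter> B = {}"
  shows "fold exec ops (override_on s t B) = override_on (fold exec ops s) t B"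
  using assms by (induction ops arbitrary: s) (simp_all add: exec_override_on[of R])

section \<open>Simulation of circuits\<close>

text \<open>The list \<open>ws\<close> holds the register of each wire, so swaps need no instruction at all.\<close>

lemma simulate_gate:
  assumes "gate_applicable (length ws) a" "b \<notin> set ws"
  shows "\<exists>ops ws'. length ops \<le> 1 \<and> length ws' = wires_after (length ws) a \<and>
    set ws' \<subseteq> insert b (set ws) \<and>
    (\<forall>i\<in>set ops. fst i = b \<and> legal (insert b (set ws)) i) \<and>
    (\<forall>s. \<not> s b \<longrightarrow> map (fold exec ops s) ws' = apply_gate a (map s ws))"
proof -
  have nth: "ws ! k \<in> set ws" "ws ! k \<noteq> b" if "k < length ws" for k
    using that assms(2) by (auto dest: nth_mem)
  have sub: "set (take j (ws[i := b]) @ drop (Suc j) (ws[i := b])) \<subseteq> insert b (set ws)" for i j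
    using set_take_subset[of j "ws[i := b]"] set_drop_subset[of "Suc j" "ws[i := b]"]
      set_update_subset_insert[of ws i b] by auto
  \<comment> \<open>Both binary gates differ only in the truth table \<open>h\<close>. The fresh
    register \<open>b\<close> takes over wire \<open>i\<close>, and the register of wire
    \<open>j\<close> is merely dropped from the list, keeping its content.\<close>
  have bin: "\<exists>ops ws'. length ops \<le> 1 \<and> length ws' = length ws - 1 \<and>
    set ws' \<subseteq> insert b (set ws) \<and>
    (\<forall>i\<in>set ops. fst i = b \<and> legal (insert b (set ws)) i) \<and>
    (\<forall>s. \<not> s b \<longrightarrow> map (fold exec ops s) ws' = remove_wire j ((map s ws)[i := h (map s ws ! i) (map s ws ! j)]))"
    if "i < length ws" "j < length ws" for i j h
    using that nth sub[of j i] assms(2)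
    by (intro exI[of _ "[(b, ws ! i, ws ! j, h)]"]
        exI[of _ "take j (ws[i := b]) @ drop (Suc j) (ws[i := b])"])
      (auto simp: remove_wire_def map_update simp flip: take_map drop_map)
  show ?thesis
  proof (cases a)
    case (AndGate i j)
    then show ?thesis using bin[of i j "(\<and>)"] assms(1) by simp
  next
    case (OrGate i j)
    then show ?thesis using bin[of i j "(\<or>)"] assms(1) by simp
  next
    case (NotGate i)
    then show ?thesis using assms nth set_update_subset_insert[of ws i b]
      by (intro exI[of _ "[(b, ws ! i, ws ! i, \<lambda>x _. \<not> x)]"] exI[of _ "ws[i := b]"])
        (auto simp: map_update)
  next
    case (ForkGate i)
    then show ?thesis using assms nth
      by (intro exI[of _ "[(b, ws ! i, ws ! i, \<lambda>x _. x)]"]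
          exI[of _ "take i ws @ [ws ! i, b] @ drop (Suc i) ws"])
        (auto simp: take_map drop_map dest: in_set_takeD in_set_dropD)
  next
    case (SwapGate i j)
    then show ?thesis using assms(1) nth
      by (intro exI[of _ "[]"] exI[of _ "ws[i := ws ! j, j := ws ! i]"])
        (auto simp: map_update dest!: set_mp[OF set_update_subset_insert])
  qed
qed

lemma legal_mono: "legal R i \<Longrightarrow> R \<subseteq> S \<Longrightarrow> legal S i"
  by (cases i) auto

text \<open>Each gate gets its own fresh register, from \<open>b\<close> on. Confining all writes to
  these keeps the registers of the remaining gates zero and never overwrites an input, as is
  required for undoing the run later.\<close>

lemma simulate_gates:
  assumes "gates_connect (length ws) gs n" "set ws \<inter> {b..<b + length gs} = {}"
  shows "\<exists>ops ws'. length ops \<le> length gs \<and> length ws' = n \<and>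
    set ws' \<subseteq> set ws \<union> {b..<b + length gs} \<and>
    (\<forall>i\<in>set ops. fst i \<in> {b..<b + length gs} \<and> legal (set ws \<union> {b..<b + length gs}) i) \<and>
    (\<forall>s. (\<forall>p\<in>{b..<b + length gs}. \<not> s p) \<longrightarrow>
       map (fold exec ops s) ws' = fold apply_gate gs (map s ws))"
  using assms
proof (induction gs arbitrary: ws b)
  case Nil
  then show ?case by (intro exI[of _ "[]"] exI[of _ ws]) simp
next
  case (Cons a gs)
  have "b \<notin> set ws" using Cons.prems(2) by auto
  then obtain ops1 ws1 where 1: "length ops1 \<le> 1" "length ws1 = wires_after (length ws) a"
    "set ws1 \<subseteq> insert b (set ws)"
    "\<And>i. i \<in> set ops1 \<Longrightarrow> fst i = b \<and> legal (insert b (set ws)) i"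
    "\<And>s. \<not> s b \<Longrightarrow> map (fold exec ops1 s) ws1 = apply_gate a (map s ws)"
    using simulate_gate[of ws a b] Cons.prems(1) by auto
  have "gates_connect (length ws1) gs n" using Cons.prems(1) 1(2) by simp
  moreover have "set ws1 \<inter> {Suc b..<Suc b + length gs} = {}"
    using 1(3) Cons.prems(2) by fastforce
  ultimately obtain ops2 ws2 where 2: "length ops2 \<le> length gs" "length ws2 = n"
    "set ws2 \<subseteq> set ws1 \<union> {Suc b..<Suc b + length gs}"
    "\<And>i. i \<in> set ops2 \<Longrightarrow> fst i \<in> {Suc b..<Suc b + length gs} \<and>
       legal (set ws1 \<union> {Suc b..<Suc b + length gs}) i"
    "\<And>s. (\<forall>p\<in>{Suc b..<Suc b + length gs}. \<not> s p) \<Longrightarrow>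
       map (fold exec ops2 s) ws2 = fold apply_gate gs (map s ws1)"
    using Cons.IH[of ws1 "Suc b"] by blast
  let ?R = "set ws \<union> {b..<b + length (a # gs)}"
  have R: "insert b (set ws) \<subseteq> ?R" "set ws1 \<union> {Suc b..<Suc b + length gs} \<subseteq> ?R"
    using 1(3) by auto
  have "map (fold exec (ops1 @ ops2) s) ws2 = fold apply_gate (a # gs) (map s ws)"
    if s: "\<forall>p\<in>{b..<b + length (a # gs)}. \<not> s p" for s
  proof -
    have "fold exec ops1 s p = s p" if "p \<noteq> b" for p
      using fold_exec_other[of ops1 p s] 1(4) that by blast
    then have "\<forall>p\<in>{Suc b..<Suc b + length gs}. \<not> fold exec ops1 s p" using s by auto
    then show ?thesis using 2(5) 1(5)[of s] s by simp
  qed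
  moreover have "length (ops1 @ ops2) \<le> length (a # gs)" using 1(1) 2(1) by simp
  moreover have "set ws2 \<subseteq> ?R" using 2(3) R(2) by blast
  moreover have "fst i \<in> {b..<b + length (a # gs)} \<and> legal ?R i" if "i \<in> set (ops1 @ ops2)" for i
  proof (cases "i \<in> set ops1")
    case True
    then show ?thesis using 1(4) legal_mono[OF _ R(1)] by auto
  next
    case False
    then have "i \<in> set ops2" using that by simp
    then show ?thesis using 2(4)[of i] legal_mono[OF _ R(2)] by auto
  qed
  ultimately show ?case using 2(2) by blast
qed

section \<open>Compute, copy, uncompute\<close>

text \<open>Disjointness ensures that later copies read sources which earlier ones have not altered.
  The bound \<open>n\<close> is there for the induction.\<close>

lemma fold_exec_copy:
  assumes "set ws \<inter> {x..<x + length ws} = {}" "n \<le> length ws"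
  shows "fold exec (map (\<lambda>k. (x + k, ws ! k, ws ! k, \<lambda>a _. a)) [0..<n]) s =
    (\<lambda>r. if x \<le> r \<and> r < x + n then s r \<noteq> s (ws ! (r - x)) else s r)"
  using assms(2)
proof (induction n)
  case (Suc n)
  have "ws ! n \<in> set ws" using Suc.prems by simp
  then have "\<not> (x \<le> ws ! n \<and> ws ! n < x + n)" using assms(1) Suc.prems by force
  then show ?case using Suc by (auto simp: fun_eq_iff less_Suc_eq)
qed (auto simp: fun_eq_iff)

definition xor_at :: "nat \<Rightarrow> bits \<Rightarrow> cantor \<Rightarrow> cantor" where
  "xor_at x v s = (\<lambda>r. if x \<le> r \<and> r < x + length v then s r \<noteq> v ! (r - x) else s r)"

text \<open>Bennett's method: after the result is added to the block at \<open>y\<close>, the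
  reversed computation clears the work registers. The empty gate list gives plain copying.\<close>

lemma compute_copy_uncompute:
  assumes "gates_connect m gs m" "length gs \<le> L" "L < x" "L < y" "x + m \<le> y \<or> y + m \<le> x"
    and "x + m \<le> Suc K" "y + m \<le> Suc K"
  shows "\<exists>ops. length ops \<le> 2 * length gs + m \<and> (\<forall>i\<in>set ops. legal {1..K} i) \<and>
    (\<forall>s. (\<forall>p\<in>{1..L}. \<not> s p) \<longrightarrow>
      fold exec ops s = xor_at y (fold apply_gate gs (map s [x..<x + m])) s)"
proof -
  let ?ws = "[x..<x + m]" let ?b = "1 :: nat"
  have "set ?ws \<inter> {?b..<?b + length gs} = {}" using assms(2,3) by auto
  moreover have "gates_connect (length ?ws) gs m" using assms(1) by simp
  ultimately obtain ops ws where ops: "length ops \<le> length gs" "length ws = m"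
    "set ws \<subseteq> set ?ws \<union> {?b..<?b + length gs}"
    "\<And>i. i \<in> set ops \<Longrightarrow> fst i \<in> {?b..<?b + length gs} \<and> legal (set ?ws \<union> {?b..<?b + length gs}) i"
    "\<And>s. (\<forall>p\<in>{?b..<?b + length gs}. \<not> s p) \<Longrightarrow>
       map (fold exec ops s) ws = fold apply_gate gs (map s ?ws)"
    using simulate_gates[of ?ws gs m ?b] by blast
  let ?R = "set ?ws \<union> {?b..<?b + length gs}" let ?B = "{y..<y + m}"
  have RB: "?R \<inter> ?B = {}" using assms by auto
  have RK: "?R \<subseteq> {1..K}" "?B \<subseteq> {1..K}" using assms by auto
  define copy :: "instruction list"
    where "copy = map (\<lambda>k. (y + k, ws ! k, ws ! k, \<lambda>a _. a)) [0..<m]"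
  have "legal {1..K} i" if i: "i \<in> set copy" for i
  proof -
    obtain k where k: "k < m" "i = (y + k, ws ! k, ws ! k, \<lambda>a _. a)"
      using i unfolding copy_def by auto
    have "ws ! k \<in> ?R" using k(1) ops(2,3) by (meson nth_mem subsetD)
    moreover have "y + k \<in> ?B" using k(1) by simp
    ultimately show ?thesis using RK RB k(2) by (metis IntI empty_iff legal.simps subsetD)
  qed
  moreover have "legal {1..K} i" if "i \<in> set ops" for i
    using ops(4)[OF that] legal_mono[OF _ RK(1)] by blast
  ultimately have "\<forall>i\<in>set (ops @ copy @ rev ops). legal {1..K} i"
    by (simp only: set_append set_rev ball_Un) blast
  moreover have "length (ops @ copy @ rev ops) \<le> 2 * length gs + m"
    using ops(1) unfolding copy_def by simp
  moreover have "fold exec (ops @ copy @ rev ops) s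
      = xor_at y (fold apply_gate gs (map s ?ws)) s" if s: "\<forall>p\<in>{1..L}. \<not> s p" for s
  proof -
    define s1 where "s1 = fold exec ops s"
    have val: "fold apply_gate gs (map s ?ws) = map s1 ws"
      using ops(5)[of s] s assms(2) unfolding s1_def by auto
    have s1: "s1 r = s r" if "r \<in> ?B" for r
      unfolding s1_def using RB ops(4) that by (intro fold_exec_other) blast
    have copy: "fold exec copy s1 = xor_at y (map s1 ws) s1"
    proof -
      have "set ws \<inter> {y..<y + length ws} = {}" using ops(2,3) RB by blast
      from fold_exec_copy[OF this, of m s1] show ?thesis
        using ops(2) unfolding copy_def xor_at_def by (auto simp: fun_eq_iff)
    qed
    \<comment> \<open>The state after copying is the computed state overridden on \<open>?B\<close>,
      so the reversed program acts as if no copy had been made.\<close>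
    have "fold exec (rev ops) (xor_at y (map s1 ws) s1)
      = fold exec (rev ops) (override_on s1 (xor_at y (map s1 ws) s1) ?B)"
      using ops(2) by (intro arg_cong[where f = "fold exec (rev ops)"])
        (auto simp: fun_eq_iff override_on_def xor_at_def)
    also have "\<dots> = override_on (fold exec (rev ops) s1) (xor_at y (map s1 ws) s1) ?B"
      using fold_exec_override_on[of "rev ops" ?R ?B] ops(4) RB by simp
    also have "fold exec (rev ops) s1 = s"
      unfolding s1_def using fold_exec_rev[of ops ?R s] ops(4) by blast
    also have "override_on s (xor_at y (map s1 ws) s1) ?B = xor_at y (map s1 ws) s"
      using s1 ops(2) by (auto simp: fun_eq_iff override_on_def xor_at_def)
    finally show ?thesis using copy val by (simp add: s1_def)
  qed
  ultimately show ?thesis by blast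
qed

section \<open>In-place evaluation of a permutation\<close>

definition xor_bits :: "bits \<Rightarrow> bits \<Rightarrow> bits" where
  "xor_bits x y = map2 (\<noteq>) x y"

lemma xor_at_conc:
  assumes "length v = length y"
  shows "xor_at (length u) v ((u @ y @ z) \<frown> t) = (u @ xor_bits y v @ z) \<frown> t"
  using assms by (auto simp: xor_bits_def fun_eq_iff xor_at_def conc_def nth_append)

lemma map_conc_block: "map ((u @ y @ z) \<frown> t) [length u..<length u + length y] = y"
  by (rule nth_equalityI) (auto simp: conc_def nth_append)

lemma xor_bits_self: "xor_bits x x = replicate (length x) False"
  unfolding xor_bits_def by (rule nth_equalityI) auto

lemma xor_bits_zero: "length x = m \<Longrightarrow> xor_bits (replicate m False) x = x"
  unfolding xor_bits_def by (rule nth_equalityI) auto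

text \<open>Adding \<open>g x\<close> to a zero block leaves \<open>x\<close> behind. The circuit
  for the inverse, run on \<open>g x\<close>, produces this \<open>x\<close> again and cancels
  it.\<close>

lemma permutation_program:
  assumes g: "bij_betw g (bitstrings m) (bitstrings m)"
    and gs: "gates_connect m gs m" "\<And>x. x \<in> bitstrings m \<Longrightarrow> fold apply_gate gs x = g x"
    and gs': "gates_connect m gs' m"
      "\<And>x. x \<in> bitstrings m \<Longrightarrow> fold apply_gate gs' x = inv_into (bitstrings m) g x"
    and L: "length gs \<le> L" "length gs' \<le> L"
  shows "\<exists>ops. length ops \<le> 2 * length gs + 2 * length gs' + 4 * m \<and>
    (\<forall>i\<in>set ops. legal {1..L + 2 * m} i) \<and>
    (\<forall>x\<in>bitstrings m. \<forall>t. fold exec ops ((replicate (Suc (L + m)) False @ x) \<frown> t) =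
      (replicate (Suc (L + m)) False @ g x) \<frown> t)"
proof -
  define K where "K = L + 2 * m"
  \<comment> \<open>\<open>u\<close> covers position 0, which no instruction touches, and the work
    registers 1 to \<open>L\<close>. The result block at \<open>Y\<close> and the input block at
    \<open>X\<close> follow, ending at position \<open>L + 2 * m\<close>.\<close>
  define u where "u = replicate (Suc L) False"
  define z where "z = replicate m False"
  define st where "st y x t = (u @ y @ x) \<frown> t" for y x t
  define Y where "Y = Suc L"
  define X where "X = Suc L + m"
  have lens: "length u = Y" "length z = m" unfolding u_def z_def Y_def by simp_all
  have anc: "\<forall>p\<in>{1..L}. \<not> st y x t p" for y x t
    unfolding st_def u_def conc_def by (auto simp: nth_append simp del: replicate_Suc)
  have readY: "map (st y x t) [Y..<Y + m] = y" if "length y = m" for y x t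
    using map_conc_block[of u y x t] that lens unfolding st_def by simp
  have readX: "map (st y x t) [X..<X + m] = x" if "length y = m" "length x = m" for y x t
    using map_conc_block[of "u @ y" x "[]" t] that lens unfolding st_def X_def Y_def by simp
  have writeY: "xor_at Y v (st y x t) = st (xor_bits y v) x t"
    if "length y = m" "length v = m" for v y x t
    using xor_at_conc[of v y u x t] that lens unfolding st_def by simp
  have writeX: "xor_at X v (st y x t) = st y (xor_bits x v) t"
    if "length y = m" "length x = m" "length v = m" for v y x t
    using xor_at_conc[of v x "u @ y" "[]" t] that lens unfolding st_def X_def Y_def by simp
  obtain ops1 where ops1: "length ops1 \<le> 2 * length gs + m" "\<forall>i\<in>set ops1. legal {1..K} i"
    "\<And>s. \<forall>p\<in>{1..L}. \<not> s p \<Longrightarrow> fold exec ops1 s = xor_at Y (fold apply_gate gs (map s [X..<X + m])) s"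
    using compute_copy_uncompute[OF gs(1) L(1), of X Y K] unfolding X_def Y_def K_def by auto
  obtain ops2 where ops2: "length ops2 \<le> 2 * length gs' + m" "\<forall>i\<in>set ops2. legal {1..K} i"
    "\<And>s. \<forall>p\<in>{1..L}. \<not> s p \<Longrightarrow> fold exec ops2 s = xor_at X (fold apply_gate gs' (map s [Y..<Y + m])) s"
    using compute_copy_uncompute[OF gs'(1) L(2), of Y X K] unfolding X_def Y_def K_def by auto
  \<comment> \<open>The empty circuit: the remaining two programs only copy between the
    blocks.\<close>
  obtain ops3 where ops3: "length ops3 \<le> m" "\<forall>i\<in>set ops3. legal {1..K} i"
    "\<And>s. \<forall>p\<in>{1..L}. \<not> s p \<Longrightarrow> fold exec ops3 s = xor_at X (map s [Y..<Y + m]) s"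
    using compute_copy_uncompute[of m "[]" L Y X K] unfolding X_def Y_def K_def by auto
  obtain ops4 where ops4: "length ops4 \<le> m" "\<forall>i\<in>set ops4. legal {1..K} i"
    "\<And>s. \<forall>p\<in>{1..L}. \<not> s p \<Longrightarrow> fold exec ops4 s = xor_at Y (map s [X..<X + m]) s"
    using compute_copy_uncompute[of m "[]" L X Y K] unfolding X_def Y_def K_def by auto
  let ?ops = "ops1 @ ops2 @ ops3 @ ops4"
  \<comment> \<open>The two blocks run through (0, x), (g x, x), (g x, 0), (g x, g x), (0, g
    x).\<close>
  have "fold exec ?ops (st z x t) = st z (g x) t" if x: "x \<in> bitstrings m" for x t
  proof -
    have gx: "g x \<in> bitstrings m" "inv_into (bitstrings m) g (g x) = x"
      using g x unfolding bij_betw_def by auto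
    have len: "length x = m" "length (g x) = m" using x gx(1) unfolding bitstrings_def by auto
    have "fold exec ops1 (st z x t) = st (g x) x t"
      using ops1(3)[OF anc] by (simp add: readX writeY gs(2)[OF x] len lens xor_bits_zero z_def)
    moreover have "fold exec ops2 (st (g x) x t) = st (g x) z t"
      using ops2(3)[OF anc] by (simp add: readY writeX gs'(2)[OF gx(1)] gx(2) len xor_bits_self z_def)
    moreover have "fold exec ops3 (st (g x) z t) = st (g x) (g x) t"
      using ops3(3)[OF anc] by (simp add: readY writeX len lens xor_bits_zero z_def)
    moreover have "fold exec ops4 (st (g x) (g x) t) = st z (g x) t"
      using ops4(3)[OF anc] by (simp add: readX writeY len lens xor_bits_self z_def)
    ultimately show ?thesis by simp
  qed
  moreover have "(replicate (Suc (L + m)) False @ x) \<frown> t = st z x t" for x t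
    unfolding st_def u_def z_def by (simp only: append_assoc[symmetric] replicate_add[symmetric] add_Suc)
  moreover have "length ?ops \<le> 2 * length gs + 2 * length gs' + 4 * m"
    using ops1(1) ops2(1) ops3(1) ops4(1) by simp
  moreover have "\<forall>i\<in>set ?ops. legal {1..L + 2 * m} i"
    using ops1(2) ops2(2) ops3(2) ops4(2) unfolding K_def set_append ball_Un by blast
  ultimately show ?thesis by metis
qed

text \<open>The power of \<open>create\<close> that supplies the \<open>L + m\<close> extra zeros
  can be undone at the end because the program restores all of them. The last position in use,
  \<open>L + 2 * m\<close>, is the subscript bound.\<close>

lemma realizable_permutation:
  assumes \<Gamma>: "\<Gamma> \<subseteq> carrier G21"
    and c: "\<And>h. realizable \<Gamma> (L + 2 * m) c (exec (1, 2, 3, h))"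
    and d: "realizable \<Gamma> (L + 2 * m) d create"
    and g: "bij_betw g (bitstrings m) (bitstrings m)"
    and gs: "gates_connect m gs m" "\<And>x. x \<in> bitstrings m \<Longrightarrow> fold apply_gate gs x = g x"
    and gs': "gates_connect m gs' m"
      "\<And>x. x \<in> bitstrings m \<Longrightarrow> fold apply_gate gs' x = inv_into (bitstrings m) g x"
    and L: "length gs \<le> L" "length gs' \<le> L"
  shows "\<exists>f. realizable \<Gamma> (L + 2 * m)
      (2 * (L + m) * d + (2 * length gs + 2 * length gs' + 4 * m) * (6 * (L + 2 * m) + c)) f \<and>
    (\<forall>x\<in>bitstrings m. \<forall>t. f ((False # x) \<frown> t) = (False # g x) \<frown> t)"
proof -
  let ?K = "L + 2 * m" and ?A = "L + m"
  let ?n = "2 * length gs + 2 * length gs' + 4 * m"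
  obtain ops where ops: "length ops \<le> ?n" "\<And>i. i \<in> set ops \<Longrightarrow> legal {1..?K} i"
    "\<And>x t. x \<in> bitstrings m \<Longrightarrow> fold exec ops ((replicate (Suc ?A) False @ x) \<frown> t) =
      (replicate (Suc ?A) False @ g x) \<frown> t"
    using permutation_program[OF g gs gs' L] by blast
  let ?c = "create ^^ ?A"
  let ?f = "inv_into UNIV ?c \<circ> (fold exec ops \<circ> ?c)"
  have cr: "realizable \<Gamma> ?K (?A * d) ?c" by (rule realizable_funpow[OF \<Gamma> d])
  have "realizable \<Gamma> ?K (length ops * (6 * ?K + c)) (fold exec ops)"
    using realizable_program[OF \<Gamma> c ops(2)] by blast
  then have "realizable \<Gamma> ?K (?n * (6 * ?K + c)) (fold exec ops)"
    using ops(1) by (rule realizable_mono[OF _ mult_le_mono1])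
  then have "realizable \<Gamma> ?K (?A * d + (?n * (6 * ?K + c) + ?A * d)) ?f"
    using cr by (intro realizable_comp realizable_inv \<Gamma>)
  moreover have "?A * d + (?n * (6 * ?K + c) + ?A * d) = 2 * ?A * d + ?n * (6 * ?K + c)"
    by (simp add: algebra_simps)
  moreover have "?f ((False # x) \<frown> t) = (False # g x) \<frown> t" if "x \<in> bitstrings m" for x t
  proof -
    have "inj ?c" using cr prefix_bijection_bij bij_is_inj unfolding realizable_def by blast
    moreover have "fold exec ops (?c ((False # x) \<frown> t)) = ?c ((False # g x) \<frown> t)"
      unfolding create_funpow by (rule ops(3)[OF that])
    ultimately show ?thesis by (simp only: comp_apply inv_f_f)
  qed
  ultimately show ?thesis by metis
qed

section \<open>Stabilization of the two halves\<close>

lemma stabilizes_partial_action: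
  assumes "\<And>s. s 0 = b \<Longrightarrow> f s 0 = b"
  shows "stabilizes (partial_action f) b"
  unfolding stabilizes_def
proof (intro allI impI)
  fix x y assume "partial_action f (b # x) = Some y"
  then have "(y \<frown> s) 0 = b" for s
    using assms[of "(b # x) \<frown> s"] unfolding partial_action_Some sends_def by simp
  \<comment> \<open>With this tail an empty \<open>y\<close> would put the negation of
    \<open>b\<close> at position 0.\<close>
  from this[of "\<lambda>_. \<not> b"] show "\<exists>z. y = b # z" by (cases y) auto
qed

text \<open>Surjectivity of \<open>g\<close> makes \<open>f\<close> map the sequences starting with
  0 onto themselves; injectivity of \<open>f\<close> then keeps all other sequences out of that
  half.\<close>

lemma head_preserved:
  assumes f: "bij f" and g: "bij_betw g (bitstrings m) (bitstrings m)"
    and fg: "\<And>x t. x \<in> bitstrings m \<Longrightarrow> f ((False # x) \<frown> t) = (False # g x) \<frown> t"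
  shows "f s 0 = s 0"
proof -
  have split: "\<exists>x\<in>bitstrings m. \<exists>t. s = (False # x) \<frown> t" if "\<not> s 0" for s
  proof -
    define x t where "x = prefix m (suffix 1 s)" and "t = suffix m (suffix 1 s)"
    have "x \<frown> t = suffix 1 s" unfolding x_def t_def by (rule prefix_suffix[symmetric])
    then have "s = (False # x) \<frown> t" using that build_first[of s] by simp
    moreover have "x \<in> bitstrings m" unfolding bitstrings_def x_def by simp
    ultimately show ?thesis by blast
  qed
  show ?thesis
  proof (cases "s 0")
    case False
    then obtain x t where "x \<in> bitstrings m" "s = (False # x) \<frown> t" using split by blast
    then show ?thesis using fg by simp
  next
    case True
    have "f s 0"
    proof (rule ccontr)
      assume "\<not> f s 0"
      then obtain y t where y: "y \<in> bitstrings m" "f s = (False # y) \<frown> t" using split by blast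
      then have "y \<in> g ` bitstrings m" using bij_betw_imp_surj_on[OF g] by simp
      then obtain x where x: "x \<in> bitstrings m" "y = g x" by blast
      have "f s = f ((False # x) \<frown> t)" unfolding fg[OF x(1)] y(2) x(2) ..
      then have "s = (False # x) \<frown> t" by (rule injD[OF bij_is_inj[OF f]])
      then show False using True by simp
    qed
    then show ?thesis using True by simp
  qed
qed

theorem theorem4p2:
  fixes \<Gamma> :: "(bits \<rightharpoonup> bits) set"
  assumes "finite \<Gamma>" and "\<Gamma> \<subseteq> carrier G21" and "generate G21 \<Gamma> = carrier G21"
  shows "\<exists>c::real. \<forall>(m::nat) (g::bits \<Rightarrow> bits) (C\<^sub>g::circuit) (C\<^sub>g\<^sub>i::circuit).
    bij_betw g (bitstrings m) (bitstrings m) \<and>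
    min_circuit C\<^sub>g m m g \<and>
    min_circuit C\<^sub>g\<^sub>i m m (inv_into (bitstrings m) g) \<longrightarrow>
    (\<exists>W \<in> words_over \<Gamma>. \<exists>w \<in> carrier G21.
       w = word_value W \<and>
       inv\<^bsub>G21\<^esub> w \<in> carrier G21 \<and>
       inv\<^bsub>G21\<^esub> w = word_value (word_inverse W) \<and>
       (\<forall>x\<in>bitstrings m. w (False # x) = Some (False # g x)) \<and>
       (\<forall>y\<in>bitstrings m.
          (inv\<^bsub>G21\<^esub> w) (False # y) = Some (False # inv_into (bitstrings m) g y)) \<and>
       stabilizes w False \<and> stabilizes w True \<and>
       stabilizes (inv\<^bsub>G21\<^esub> w) False \<and> stabilizes (inv\<^bsub>G21\<^esub> w) True \<and>
       length W = length (word_inverse W) \<and>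
       real (length W) \<le> c * (real (circuit_size C\<^sub>g) ^ 4 + real (circuit_size C\<^sub>g\<^sub>i) ^ 4) \<and>
       (\<forall>i s. (Tau i, s) \<in> set W \<longrightarrow>
          i \<le> max ((circuit_size C\<^sub>g)\<^sup>2) ((circuit_size C\<^sub>g\<^sub>i)\<^sup>2) + 2))"
proof -
  have \<Gamma>: "\<Gamma> \<subseteq> carrier G21" by (rule assms(2))
  obtain c where c: "\<And>h K. realizable \<Gamma> K c (exec (1, 2, 3, h))"
    using realizable_exec_front[OF \<Gamma> assms(3)] by blast
  obtain d where d: "\<And>K. realizable \<Gamma> K d create"
    using realizable_const[OF \<Gamma> assms(3) create_prefix_bijection] by blast
  show ?thesis
  \<comment> \<open>The summands are the coefficients of
    \<open>2 * ?M * d + (4 * ?M) * (6 * ?M + c)\<close>, with linear terms absorbed by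
    \<open>?M \<le> ?M * ?M\<close>.\<close>
  proof (intro exI[of _ "real (2 * d + 24 + 4 * c)"] allI impI, elim conjE)
    fix m g C\<^sub>g C\<^sub>g\<^sub>i
    assume g: "bij_betw g (bitstrings m) (bitstrings m)"
      and C: "min_circuit C\<^sub>g m m g" "min_circuit C\<^sub>g\<^sub>i m m (inv_into (bitstrings m) g)"
    let ?g' = "inv_into (bitstrings m) g"
    define gs gs' where "gs = gates C\<^sub>g" and "gs' = gates C\<^sub>g\<^sub>i"
    have gs: "gates_connect m gs m" "\<And>x. x \<in> bitstrings m \<Longrightarrow> fold apply_gate gs x = g x"
      and size: "circuit_size C\<^sub>g = length gs + 2 * m"
      using C(1) unfolding min_circuit_def computes_def circuit_size_def gs_def by auto
    have gs': "gates_connect m gs' m" "\<And>x. x \<in> bitstrings m \<Longrightarrow> fold apply_gate gs' x = ?g' x"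
      and size': "circuit_size C\<^sub>g\<^sub>i = length gs' + 2 * m"
      using C(2) unfolding min_circuit_def computes_def circuit_size_def gs'_def by auto
    let ?L = "max (length gs) (length gs')"
    let ?M = "max (circuit_size C\<^sub>g) (circuit_size C\<^sub>g\<^sub>i)"
    let ?n = "2 * (?L + m) * d + (2 * length gs + 2 * length gs' + 4 * m) * (6 * (?L + 2 * m) + c)"
    \<comment> \<open>The ports contribute \<open>2 * m\<close> to each size, so the last register
      position is exactly the larger size.\<close>
    have M: "?L + 2 * m = ?M" using size size' by simp
    obtain f where real: "realizable \<Gamma> (?L + 2 * m) ?n f"
      and fg: "\<And>x t. x \<in> bitstrings m \<Longrightarrow> f ((False # x) \<frown> t) = (False # g x) \<frown> t"
      using realizable_permutation[OF \<Gamma> c d g gs gs' max.cobounded1 max.cobounded2] by blast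
    from real obtain W where f: "f \<in> prefix_bijections" and W: "W \<in> words_over \<Gamma>"
      "word_value W = partial_action f" "length W \<le> ?n"
      "\<And>i s. (Tau i, s) \<in> set W \<Longrightarrow> i \<le> ?M"
      unfolding realizable_def M by blast
    let ?w = "word_value W" and ?f' = "inv_into UNIV f"
    have bij: "bij f" by (rule prefix_bijection_bij[OF f])
    have inv: "inv\<^bsub>G21\<^esub> ?w = partial_action ?f'" using W(2) G21_inv[OF f] by simp
    have snd: "sends f (False # x) (False # g x)" if "x \<in> bitstrings m" for x
      unfolding sends_def using fg[OF that] by blast
    have snd': "sends ?f' (False # y) (False # ?g' y)" if "y \<in> bitstrings m" for y
    proof -
      have "?g' y \<in> bitstrings m" "g (?g' y) = y"
        using g that unfolding bij_betw_def by (auto intro: inv_into_into f_inv_into_f)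
      then show ?thesis using sends_inv[OF bij snd] by metis
    qed
    have head: "f s 0 = s 0" for s by (rule head_preserved[OF bij g fg])
    have head': "?f' s 0 = s 0" for s
      using head[of "?f' s"] bij by (metis bij_inv_eq_iff)
    \<comment> \<open>Both \<open>?L + m\<close> and a quarter of the instruction bound are at most
      \<open>?M\<close>.\<close>
    have "?n \<le> 2 * ?M * d + (4 * ?M) * (6 * ?M + c)"
      unfolding M using size size' by (intro add_mono mult_mono) (auto simp: max_def)
    also have "\<dots> \<le> (2 * d + 24 + 4 * c) * (?M * ?M)"
      using le_square[of ?M] by (simp add: algebra_simps add_mono mult_le_mono)
    \<comment> \<open>The quadratic bound is weakened to fourth powers; \<open>?M ^ 4\<close> is one
      of the two summands.\<close>
    also have "\<dots> \<le> (2 * d + 24 + 4 * c) * (circuit_size C\<^sub>g ^ 4 + circuit_size C\<^sub>g\<^sub>i ^ 4)"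
    proof (rule mult_le_mono2)
      have "?M * ?M \<le> (?M * ?M) * (?M * ?M)" by (rule le_square)
      also have "\<dots> = ?M ^ 4" by (simp add: power4_eq_xxxx)
      also have "\<dots> \<le> circuit_size C\<^sub>g ^ 4 + circuit_size C\<^sub>g\<^sub>i ^ 4" by (simp add: max_def)
      finally show "?M * ?M \<le> circuit_size C\<^sub>g ^ 4 + circuit_size C\<^sub>g\<^sub>i ^ 4" .
    qed
    finally have len: "length W \<le> (2 * d + 24 + 4 * c) * (circuit_size C\<^sub>g ^ 4 + circuit_size C\<^sub>g\<^sub>i ^ 4)"
      using W(3) by (rule order_trans[rotated])
    have bound: "real (length W) \<le> real (2 * d + 24 + 4 * c) *
        (real (circuit_size C\<^sub>g) ^ 4 + real (circuit_size C\<^sub>g\<^sub>i) ^ 4)"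
      using of_nat_mono[OF len, where 'a = real] by simp
    have index: "?M \<le> max ((circuit_size C\<^sub>g)\<^sup>2) ((circuit_size C\<^sub>g\<^sub>i)\<^sup>2)"
      by (intro max.mono) (simp_all add: power2_eq_square)
    show "\<exists>W\<in>words_over \<Gamma>. \<exists>w\<in>carrier G21.
       w = word_value W \<and>
       inv\<^bsub>G21\<^esub> w \<in> carrier G21 \<and>
       inv\<^bsub>G21\<^esub> w = word_value (word_inverse W) \<and>
       (\<forall>x\<in>bitstrings m. w (False # x) = Some (False # g x)) \<and>
       (\<forall>y\<in>bitstrings m. (inv\<^bsub>G21\<^esub> w) (False # y) = Some (False # ?g' y)) \<and>
       stabilizes w False \<and> stabilizes w True \<and>
       stabilizes (inv\<^bsub>G21\<^esub> w) False \<and> stabilizes (inv\<^bsub>G21\<^esub> w) True \<and>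
       length W = length (word_inverse W) \<and>
       real (length W) \<le> real (2 * d + 24 + 4 * c) *
         (real (circuit_size C\<^sub>g) ^ 4 + real (circuit_size C\<^sub>g\<^sub>i) ^ 4) \<and>
       (\<forall>i s. (Tau i, s) \<in> set W \<longrightarrow>
          i \<le> max ((circuit_size C\<^sub>g)\<^sup>2) ((circuit_size C\<^sub>g\<^sub>i)\<^sup>2) + 2)"
    proof (intro bexI[OF _ W(1)] bexI[OF _ word_value_closed[OF \<Gamma> W(1)]] conjI)
      show "inv\<^bsub>G21\<^esub> ?w \<in> carrier G21"
        unfolding inv carrier_G21 using inv_prefix_bijection[OF f] by blast
      show "inv\<^bsub>G21\<^esub> ?w = word_value (word_inverse W)"
        by (rule word_value_inverse[OF \<Gamma> W(1), symmetric])
      show "\<forall>x\<in>bitstrings m. ?w (False # x) = Some (False # g x)"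
        unfolding W(2) partial_action_Some using snd by blast
      show "\<forall>y\<in>bitstrings m. (inv\<^bsub>G21\<^esub> ?w) (False # y) = Some (False # ?g' y)"
        unfolding inv partial_action_Some using snd' by blast
      show "stabilizes ?w False" "stabilizes ?w True"
        unfolding W(2) using head by (auto intro: stabilizes_partial_action)
      show "stabilizes (inv\<^bsub>G21\<^esub> ?w) False" "stabilizes (inv\<^bsub>G21\<^esub> ?w) True"
        unfolding inv using head' by (auto intro: stabilizes_partial_action)
      show "length W = length (word_inverse W)" by (simp add: length_word_inverse)
      show "\<forall>i s. (Tau i, s) \<in> set W \<longrightarrow>
          i \<le> max ((circuit_size C\<^sub>g)\<^sup>2) ((circuit_size C\<^sub>g\<^sub>i)\<^sup>2) + 2"
        using W(4) index by (meson order_trans trans_le_add1)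
    qed (rule refl bound)+
  qed
qed

end
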